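(* Let $H\in(0,1)$ and let $X=\{X_f,\ f\in L^2(T,m)\}$ be a real-valued Gaussian process. Then $X$ is, up to normalization of its variance, an $L^2$-fractional Brownian motion of parameter $H$, namely $X$ is centred and there is a constant $\sigma^2\ge 0$ with $$\mathbb{E}(X_fX_g)=\frac{\sigma^2}{2}\left(m(f^2)^{2H}+m(g^2)^{2H}-m((f-g)^2)^{2H}\right)\quad\text{for all } f,g\in L^2(T,m),$$ if and only if $X$ satisfies both of the following properties: (SI2) (weak $L^2$-increment stationarity) for every $n\in\mathbb{N}$ and all $f_1,\dots,f_n,g_1,\dots,g_n,h\in L^2(T,m)$, $$\left(X_{f_1+h}-X_{g_1+h},\dots,X_{f_n+h}-X_{g_n+h}\right)\overset{(d)}{=}\left(X_{f_1}-X_{g_1},\dots,X_{f_n}-X_{g_n}\right);$$ (SS2) (strong $H$-self-similarity) for every $\varphi\in\mathcal{G}$, $\{X_{\varphi(f)},\ f\in L^2(T,m)\}\overset{(d)}{=}\{\varrho(\varphi)^HX_f,\ f\in L^2(T,m)\}$.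
   Context: $T$ is a separable and complete metric space with a measure $m$ such that the real Hilbert space $L^2(T,m)$ is separable; $\|\cdot\|$ is its norm and $m(f^2)=\int_T f^2\,\mathrm{d}m=\|f\|^2$. $\mathcal{G}$ is the set of invertible bounded linear maps $\varphi:L^2(T,m)\to L^2(T,m)$ such that for all $f,g\in L^2(T,m)$, $\|f\|=\|g\|$ implies $\|\varphi(f)\|=\|\varphi(g)\|$. $\varrho:\mathcal{G}\to\mathbb{R}_+$ maps $\varphi$ to the square of its operator norm, so that $\|\varphi(f)\|=\sqrt{\varrho(\varphi)}\,\|f\|$ for all $f$. $\overset{(d)}{=}$ means equality in law (of finite-dimensional distributions for processes). "Gaussian process" is not assumed centred a priori, and constants are regarded as (degenerate) Gaussian variables. *)

theory Defs
  imports "HOL-Probability.Probability"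
begin

section \<open>The space \<open>L\<^sup>2(T, m)\<close>\<close>

text \<open>
  \<open>L\<^sup>2(T, m)\<close> is realised as the set of classes modulo almost everywhere equality. The operations
  act on a chosen representative of each class; the lemmas below show that the choice is irrelevant.
\<close>

definition square_integrable :: "'t measure \<Rightarrow> ('t \<Rightarrow> real) set" where
  "square_integrable m = {f \<in> borel_measurable m. integrable m (\<lambda>t. (f t)\<^sup>2)}"

definition ae_eq_rel :: "'t measure \<Rightarrow> (('t \<Rightarrow> real) \<times> ('t \<Rightarrow> real)) set" where
  "ae_eq_rel m = {(f, g). f \<in> square_integrable m \<and> g \<in> square_integrable m \<and> (AE t in m. f t = g t)}"

definition L2 :: "'t measure \<Rightarrow> ('t \<Rightarrow> real) set set" where
  "L2 m = square_integrable m // ae_eq_rel m"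

definition L2_class :: "'t measure \<Rightarrow> ('t \<Rightarrow> real) \<Rightarrow> ('t \<Rightarrow> real) set" where
  "L2_class m f = ae_eq_rel m `` {f}"

definition L2_rep :: "('t \<Rightarrow> real) set \<Rightarrow> 't \<Rightarrow> real" where
  "L2_rep F = (SOME f. f \<in> F)"

definition L2_add :: "'t measure \<Rightarrow> ('t \<Rightarrow> real) set \<Rightarrow> ('t \<Rightarrow> real) set \<Rightarrow> ('t \<Rightarrow> real) set" where
  "L2_add m F G = L2_class m (\<lambda>t. L2_rep F t + L2_rep G t)"

definition L2_scale :: "'t measure \<Rightarrow> real \<Rightarrow> ('t \<Rightarrow> real) set \<Rightarrow> ('t \<Rightarrow> real) set" where
  "L2_scale m c F = L2_class m (\<lambda>t. c * L2_rep F t)"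

definition L2_diff :: "'t measure \<Rightarrow> ('t \<Rightarrow> real) set \<Rightarrow> ('t \<Rightarrow> real) set \<Rightarrow> ('t \<Rightarrow> real) set" where
  "L2_diff m F G = L2_class m (\<lambda>t. L2_rep F t - L2_rep G t)"

text \<open>The quantity written \<open>m(f\<^sup>2)\<close>.\<close>

definition L2_sq :: "'t measure \<Rightarrow> ('t \<Rightarrow> real) set \<Rightarrow> real" where
  "L2_sq m F = (\<integral>t. (L2_rep F t)\<^sup>2 \<partial>m)"

definition L2_norm :: "'t measure \<Rightarrow> ('t \<Rightarrow> real) set \<Rightarrow> real" where
  "L2_norm m F = sqrt (L2_sq m F)"

definition L2_separable :: "'t measure \<Rightarrow> bool" where
  "L2_separable m \<longleftrightarrow>
     (\<exists>D. countable D \<and> D \<subseteq> L2 m \<and>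
          (\<forall>F\<in>L2 m. \<forall>e>0. \<exists>G\<in>D. L2_norm m (L2_diff m F G) < e))"

lemma square_integrable_add:
  assumes "f \<in> square_integrable m" "g \<in> square_integrable m"
  shows "(\<lambda>t. f t + g t) \<in> square_integrable m"
proof -
  have [measurable]: "f \<in> borel_measurable m" "g \<in> borel_measurable m"
    using assms by (auto simp: square_integrable_def)
  have "integrable m (\<lambda>t. 2 * (f t)\<^sup>2 + 2 * (g t)\<^sup>2)"
    using assms by (auto simp: square_integrable_def)
  then have "integrable m (\<lambda>t. (f t + g t)\<^sup>2)"
  proof (rule Bochner_Integration.integrable_bound)
    show "AE t in m. norm ((f t + g t)\<^sup>2) \<le> norm (2 * (f t)\<^sup>2 + 2 * (g t)\<^sup>2)"
    proof (rule AE_I2)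
      fix t
      have "0 \<le> (f t - g t)\<^sup>2" by simp
      then have "(f t + g t)\<^sup>2 \<le> 2 * (f t)\<^sup>2 + 2 * (g t)\<^sup>2"
        by (simp add: power2_eq_square algebra_simps)
      then show "norm ((f t + g t)\<^sup>2) \<le> norm (2 * (f t)\<^sup>2 + 2 * (g t)\<^sup>2)"
        by simp
    qed
  qed measurable
  then show ?thesis by (simp add: square_integrable_def)
qed

lemma square_integrable_scale:
  assumes "f \<in> square_integrable m"
  shows "(\<lambda>t. c * f t) \<in> square_integrable m"
  using assms by (auto simp: square_integrable_def power_mult_distrib)

lemma square_integrable_diff:
  assumes "f \<in> square_integrable m" "g \<in> square_integrable m"
  shows "(\<lambda>t. f t - g t) \<in> square_integrable m"
  using square_integrable_add[OF assms(1) square_integrable_scale[OF assms(2), of "- 1"]] by simp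

lemma equiv_ae_eq_rel: "equiv (square_integrable m) (ae_eq_rel m)"
proof (rule equivI)
  show "ae_eq_rel m \<subseteq> square_integrable m \<times> square_integrable m"
    by (auto simp: ae_eq_rel_def)
  show "refl_on (square_integrable m) (ae_eq_rel m)"
    by (auto simp: refl_on_def ae_eq_rel_def)
  show "sym (ae_eq_rel m)"
    by (auto simp: sym_def ae_eq_rel_def elim!: eventually_mono)
  show "trans (ae_eq_rel m)"
  proof (rule transI)
    fix f g h assume "(f, g) \<in> ae_eq_rel m" "(g, h) \<in> ae_eq_rel m"
    then show "(f, h) \<in> ae_eq_rel m"
      by (auto simp: ae_eq_rel_def elim: eventually_elim2)
  qed
qed

lemma L2_rep_class:
  assumes "f \<in> square_integrable m"
  shows "(f, L2_rep (L2_class m f)) \<in> ae_eq_rel m"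
proof -
  have "f \<in> L2_class m f"
    using assms equiv_class_self[OF equiv_ae_eq_rel] by (simp add: L2_class_def)
  then have "L2_rep (L2_class m f) \<in> L2_class m f"
    unfolding L2_rep_def by (rule someI[of "\<lambda>g. g \<in> L2_class m f"])
  then show ?thesis by (simp add: L2_class_def)
qed

lemma L2_class_eqI: "(f, g) \<in> ae_eq_rel m \<Longrightarrow> L2_class m g = L2_class m f"
  unfolding L2_class_def by (metis equiv_class_eq equiv_ae_eq_rel)

lemma L2_add_class:
  assumes "f \<in> square_integrable m" "g \<in> square_integrable m"
  shows "L2_add m (L2_class m f) (L2_class m g) = L2_class m (\<lambda>t. f t + g t)"
  unfolding L2_add_def using L2_rep_class[OF assms(1)] L2_rep_class[OF assms(2)]
  by (intro L2_class_eqI) (auto simp: ae_eq_rel_def square_integrable_add elim: eventually_elim2)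

lemma L2_scale_class:
  assumes "f \<in> square_integrable m"
  shows "L2_scale m c (L2_class m f) = L2_class m (\<lambda>t. c * f t)"
  unfolding L2_scale_def using L2_rep_class[OF assms]
  by (intro L2_class_eqI) (auto simp: ae_eq_rel_def square_integrable_scale elim: eventually_mono)

lemma L2_diff_class:
  assumes "f \<in> square_integrable m" "g \<in> square_integrable m"
  shows "L2_diff m (L2_class m f) (L2_class m g) = L2_class m (\<lambda>t. f t - g t)"
  unfolding L2_diff_def using L2_rep_class[OF assms(1)] L2_rep_class[OF assms(2)]
  by (intro L2_class_eqI) (auto simp: ae_eq_rel_def square_integrable_diff elim: eventually_elim2)

lemma L2_sq_class:
  assumes "f \<in> square_integrable m"
  shows "L2_sq m (L2_class m f) = (\<integral>t. (f t)\<^sup>2 \<partial>m)"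
  unfolding L2_sq_def using L2_rep_class[OF assms]
  by (intro integral_cong_AE) (auto simp: ae_eq_rel_def square_integrable_def elim: eventually_mono)


section \<open>The group \<open>\<G>\<close> and the map \<open>\<rho>\<close>\<close>

definition L2_bounded_linear :: "'t measure \<Rightarrow> (('t \<Rightarrow> real) set \<Rightarrow> ('t \<Rightarrow> real) set) \<Rightarrow> bool" where
  "L2_bounded_linear m \<phi> \<longleftrightarrow>
     \<phi> \<in> L2 m \<rightarrow> L2 m \<and>
     (\<forall>F\<in>L2 m. \<forall>G\<in>L2 m. \<phi> (L2_add m F G) = L2_add m (\<phi> F) (\<phi> G)) \<and>
     (\<forall>c. \<forall>F\<in>L2 m. \<phi> (L2_scale m c F) = L2_scale m c (\<phi> F)) \<and>
     (\<exists>K. \<forall>F\<in>L2 m. L2_norm m (\<phi> F) \<le> K * L2_norm m F)"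

text \<open>
  Boundedness of the inverse is not required separately: it follows from the bounded inverse
  theorem, and here already from the condition on norms.
\<close>

definition G_maps :: "'t measure \<Rightarrow> (('t \<Rightarrow> real) set \<Rightarrow> ('t \<Rightarrow> real) set) set" where
  "G_maps m = {\<phi>. L2_bounded_linear m \<phi> \<and> bij_betw \<phi> (L2 m) (L2 m) \<and>
     (\<forall>F\<in>L2 m. \<forall>G\<in>L2 m. L2_norm m F = L2_norm m G \<longrightarrow> L2_norm m (\<phi> F) = L2_norm m (\<phi> G))}"

text \<open>
  The operator norm follows the library's \<^const>\<open>onorm\<close>: the zero class contributes
  \<open>0 / 0 = 0\<close>, so the supremum is over a nonempty set even if \<open>L\<^sup>2(T, m)\<close> is trivial.
\<close>

definition L2_onorm :: "'t measure \<Rightarrow> (('t \<Rightarrow> real) set \<Rightarrow> ('t \<Rightarrow> real) set) \<Rightarrow> real" where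
  "L2_onorm m \<phi> = (SUP F\<in>L2 m. L2_norm m (\<phi> F) / L2_norm m F)"

definition rho :: "'t measure \<Rightarrow> (('t \<Rightarrow> real) set \<Rightarrow> ('t \<Rightarrow> real) set) \<Rightarrow> real" where
  "rho m \<phi> = (L2_onorm m \<phi>)\<^sup>2"


section \<open>Gaussian processes and equality in law\<close>

definition gaussian_rv :: "'w measure \<Rightarrow> ('w \<Rightarrow> real) \<Rightarrow> bool" where
  "gaussian_rv P Y \<longleftrightarrow> Y \<in> borel_measurable P \<and>
     ((\<exists>c. AE \<omega> in P. Y \<omega> = c) \<or>
      (\<exists>\<mu> \<sigma>. \<sigma> > 0 \<and> distributed P lborel Y (normal_density \<mu> \<sigma>)))"

definition gaussian_process :: "'w measure \<Rightarrow> 'i set \<Rightarrow> ('i \<Rightarrow> 'w \<Rightarrow> real) \<Rightarrow> bool" where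
  "gaussian_process P I X \<longleftrightarrow>
     (\<forall>i\<in>I. X i \<in> borel_measurable P) \<and>
     (\<forall>J c. finite J \<and> J \<subseteq> I \<longrightarrow> gaussian_rv P (\<lambda>\<omega>. \<Sum>j\<in>J. c j * X j \<omega>))"

definition vector_law :: "'w measure \<Rightarrow> nat \<Rightarrow> (nat \<Rightarrow> 'w \<Rightarrow> real) \<Rightarrow> (nat \<Rightarrow> real) measure" where
  "vector_law P n Z = distr P (Pi\<^sub>M {..<n} (\<lambda>_. borel)) (\<lambda>\<omega>. \<lambda>i\<in>{..<n}. Z i \<omega>)"

definition same_fdds :: "'w measure \<Rightarrow> 'i set \<Rightarrow> ('i \<Rightarrow> 'w \<Rightarrow> real) \<Rightarrow> ('i \<Rightarrow> 'w \<Rightarrow> real) \<Rightarrow> bool" where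
  "same_fdds P I X Y \<longleftrightarrow>
     (\<forall>n. \<forall>f \<in> {..<n} \<rightarrow> I. vector_law P n (\<lambda>i. X (f i)) = vector_law P n (\<lambda>i. Y (f i)))"


section \<open>\<open>L\<^sup>2\<close>-fractional Brownian motion and its characteristic properties\<close>

definition L2_fBm_up_to_variance ::
  "'t measure \<Rightarrow> 'w measure \<Rightarrow> real \<Rightarrow> (('t \<Rightarrow> real) set \<Rightarrow> 'w \<Rightarrow> real) \<Rightarrow> bool" where
  "L2_fBm_up_to_variance m P H X \<longleftrightarrow>
     (\<forall>F\<in>L2 m. (\<integral>\<omega>. X F \<omega> \<partial>P) = 0) \<and>
     (\<exists>\<sigma>2\<ge>0. \<forall>F\<in>L2 m. \<forall>G\<in>L2 m.
        (\<integral>\<omega>. X F \<omega> * X G \<omega> \<partial>P) =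
          \<sigma>2 / 2 * (L2_sq m F powr (2 * H) + L2_sq m G powr (2 * H)
                      - L2_sq m (L2_diff m F G) powr (2 * H)))"

definition weak_L2_increment_stationary ::
  "'t measure \<Rightarrow> 'w measure \<Rightarrow> (('t \<Rightarrow> real) set \<Rightarrow> 'w \<Rightarrow> real) \<Rightarrow> bool" where
  "weak_L2_increment_stationary m P X \<longleftrightarrow>
     (\<forall>n. \<forall>f \<in> {..<n} \<rightarrow> L2 m. \<forall>g \<in> {..<n} \<rightarrow> L2 m. \<forall>h \<in> L2 m.
        vector_law P n (\<lambda>i \<omega>. X (L2_add m (f i) h) \<omega> - X (L2_add m (g i) h) \<omega>) =
        vector_law P n (\<lambda>i \<omega>. X (f i) \<omega> - X (g i) \<omega>))"

definition strong_self_similar ::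
  "'t measure \<Rightarrow> 'w measure \<Rightarrow> real \<Rightarrow> (('t \<Rightarrow> real) set \<Rightarrow> 'w \<Rightarrow> real) \<Rightarrow> bool" where
  "strong_self_similar m P H X \<longleftrightarrow>
     (\<forall>\<phi>\<in>G_maps m. same_fdds P (L2 m) (\<lambda>F. X (\<phi> F)) (\<lambda>F \<omega>. rho m \<phi> powr H * X F \<omega>))"

end

theory Submission imports Defs begin

text \<open>
  For jointly Gaussian families, equality in law is equality of means and covariances, so every
  property in the theorem is a statement about second order moments. The passage from moments to
  laws of vectors is \<open>gaussian_vector_law_eq\<close>: every linear combination of the components is a
  Gaussian variable, whose law is fixed by two moments, and the laws of all linear combinations
  determine the law of the vector (Cramer-Wold, \<open>cramer_wold\<close>).

  If \<open>X\<close> is a fractional Brownian motion, the covariance of two increments depends only on the four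
  differences of their endpoints. Translations preserve differences, which is increment
  stationarity; a map \<open>\<phi>\<close> of the group multiplies \<open>m(f\<^sup>2)\<close> by \<open>\<rho>(\<phi>)\<close> and commutes with differences,
  so it multiplies the covariance by \<open>\<rho>(\<phi>)\<^bsup>2H\<^esup>\<close>, which is self-similarity.

  Conversely, the group contains enough maps to fix the covariance. Doubling fixes \<open>0\<close> and has
  \<open>\<rho> \<noteq> 1\<close>, which forces \<open>X\<^sub>0 = 0\<close>; increments \<open>X\<^sub>f - X\<^sub>g\<close> are then distributed like \<open>X\<^bsub>f - g\<^esub>\<close>. The
  map \<open>- id\<close> has \<open>\<rho> = 1\<close>, so \<open>X\<^bsub>- f\<^esub>\<close> has the mean of \<open>X\<^sub>f\<close>, while as an increment from \<open>f\<close> to \<open>0\<close> it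
  has the mean of \<open>- X\<^sub>f\<close>: the process is centred. Reflections carry any vector to any other of
  equal norm (\<open>G_maps_transitive_on_spheres\<close>) and dilations relate spheres of different radii;
  together they give \<open>E(X\<^sub>f\<^sup>2) = \<sigma>\<^sup>2 m(f\<^sup>2)\<^bsup>2H\<^esup>\<close> with one constant \<open>\<sigma>\<^sup>2\<close>
  (\<open>self_similar_second_moment\<close>). Polarizing the variance of the increments yields the covariance.
\<close>


section \<open>The Cramer-Wold device\<close>

text \<open>
  Levy's uniqueness theorem concerns probability measures. At \<open>t = 0\<close> the characteristic function
  gives the total mass, so both measures can be normalized by the same constant.
\<close>

lemma finite_measure_eqI_char:
  fixes M N :: "real measure"
  assumes "finite_measure M" "finite_measure N"
    and [measurable_cong, simp]: "sets M = sets borel" "sets N = sets borel"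
    and char: "\<And>t. (CLINT x|M. iexp (t * x)) = (CLINT x|N. iexp (t * x))"
  shows "M = N"
proof -
  interpret M: finite_measure M by fact
  interpret N: finite_measure N by fact
  have sp[simp]: "space M = UNIV" "space N = UNIV"
    using sets_eq_imp_space_eq[of M borel] sets_eq_imp_space_eq[of N borel] by auto
  define c where "c = measure M UNIV"
  have cN: "measure N UNIV = c"
    using char[of 0] by (simp add: c_def)
  show ?thesis
  proof (cases "c = 0")
    case True
    have "emeasure M A = emeasure N A" for A
    proof -
      have "emeasure M A \<le> emeasure M UNIV" "emeasure N A \<le> emeasure N UNIV"
        by (metis emeasure_space sp)+
      then show ?thesis
        using True cN
        by (simp add: c_def M.emeasure_eq_measure N.emeasure_eq_measure measure_le_0_iff)
    qed
    then show ?thesis by (intro measure_eqI) auto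
  next
    case False
    then have c: "c > 0" by (simp add: c_def zero_less_measure_iff)
    define M' where "M' = density M (\<lambda>_. ennreal (1 / c))"
    define N' where "N' = density N (\<lambda>_. ennreal (1 / c))"
    have e: "emeasure M' A = ennreal (measure M A / c)" "emeasure N' A = ennreal (measure N A / c)"
      if "A \<in> sets borel" for A
      using that c unfolding M'_def N'_def
      by (auto simp: emeasure_density nn_integral_cmult_indicator M.emeasure_eq_measure
          N.emeasure_eq_measure ennreal_mult'[symmetric])
    have "prob_space M'" "prob_space N'"
      using c cN e[of UNIV] by (auto intro!: prob_spaceI simp: c_def)
        (auto simp: M'_def N'_def)
    then have "real_distribution M'" "real_distribution N'"
      by (auto simp: real_distribution_def real_distribution_axioms_def M'_def N'_def)
    moreover have "char M' = char N'"
    proof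
      fix t
      show "char M' t = char N' t"
        using c char[of t] by (simp add: char_def M'_def N'_def integral_density)
    qed
    ultimately have "M' = N'" by (rule Levy_uniqueness)
    have "emeasure M A = emeasure N A" if "A \<in> sets M" for A
    proof -
      have "ennreal (measure M A / c) = ennreal (measure N A / c)"
        using e[of A] \<open>M' = N'\<close> that by simp
      then have "measure M A = measure N A"
        using c by (simp add: divide_right_mono)
      then show ?thesis by (simp add: M.emeasure_eq_measure N.emeasure_eq_measure)
    qed
    then show ?thesis by (intro measure_eqI) auto
  qed
qed

lemma (in finite_measure) integrable_iexp_bounded:
  assumes [measurable]: "f \<in> borel_measurable M"
  shows "integrable M (\<lambda>x. iexp (f x))"
  by (intro integrable_const_bound[where B = 1]) auto

text \<open>
  A nonnegative weight turns the law of \<open>Y\<close> into another finite measure on the line, to which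
  one-dimensional uniqueness applies. The choice of weights carries the information about the
  remaining coordinates in \<open>char_eq_imp_box_eq\<close>.
\<close>

lemma weighted_char_eq_imp_indicator_eq:
  fixes Y :: "'a \<Rightarrow> real" and Z :: "'b \<Rightarrow> real"
  assumes "finite_measure M" "finite_measure N"
    and [measurable]: "Y \<in> borel_measurable M" "Z \<in> borel_measurable N"
    and v[measurable]: "v \<in> borel_measurable M" "\<And>x. 0 \<le> v x" "\<And>x. v x \<le> B"
    and w[measurable]: "w \<in> borel_measurable N" "\<And>x. 0 \<le> w x" "\<And>x. w x \<le> B"
    and char: "\<And>s. (CLINT x|M. v x *\<^sub>R iexp (s * Y x)) = (CLINT x|N. w x *\<^sub>R iexp (s * Z x))"
    and A[measurable]: "A \<in> sets borel"
  shows "(\<integral>x. v x * indicator A (Y x) \<partial>M) = (\<integral>x. w x * indicator A (Z x) \<partial>N)"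
proof -
  interpret M: finite_measure M by fact
  interpret N: finite_measure N by fact
  define M' where "M' = distr (density M v) borel Y"
  define N' where "N' = distr (density N w) borel Z"
  have "integrable M v" "integrable N w"
    using v w by (auto intro!: M.integrable_const_bound[where B = B] N.integrable_const_bound[where B = B])
  then have "finite_measure (density M v)" "finite_measure (density N w)"
    using v w by (auto intro!: finite_measureI simp: emeasure_density nn_integral_eq_integral
        simp del: nn_integral_indicator) 
  then have fin: "finite_measure M'" "finite_measure N'"
    unfolding M'_def N'_def by (auto intro!: finite_measure.finite_measure_distr)
  have "M' = N'"
  proof (rule finite_measure_eqI_char[OF fin])
    fix t
    show "(CLINT x|M'. iexp (t * x)) = (CLINT x|N'. iexp (t * x))"
      using char[of t] v w unfolding M'_def N'_def
      by (simp add: integral_distr integral_density)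
  qed (auto simp: M'_def N'_def)
  moreover have "(\<integral>x. f x \<partial>M') = (\<integral>x. v x * f (Y x) \<partial>M)" "(\<integral>x. f x \<partial>N') = (\<integral>x. w x * f (Z x) \<partial>N)"
    if [measurable]: "f \<in> borel_measurable borel" for f :: "real \<Rightarrow> real"
    using v w unfolding M'_def N'_def by (simp_all add: integral_distr integral_density)
  ultimately show ?thesis
    using A by (metis borel_measurable_indicator)
qed

text \<open>
  Uniqueness of multivariate characteristic functions on boxes, by induction on the number of
  coordinates. To split off a coordinate \<open>Y\<^sub>k\<close>, the complex factor \<open>exp (\<i> S)\<close> of the other
  coordinates has to be treated as a weight. It is not positive, but its real and imaginary parts
  become so after adding \<open>1\<close>: the weights \<open>1 + cos (S - \<theta>)\<close> with \<open>\<theta> = 0\<close> and \<open>\<theta> = \<pi> / 2\<close> are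
  nonnegative, and their weighted characteristic functions are combinations of the given ones.
  Hence, after restriction to \<open>Y\<^sub>k \<in> A\<^sub>k\<close>, the other coordinates still have equal characteristic
  functions; the measures must therefore be arbitrary finite measures in the induction.
\<close>

lemma char_eq_imp_box_eq:
  fixes Y :: "'i \<Rightarrow> 'a \<Rightarrow> real" and Z :: "'i \<Rightarrow> 'b \<Rightarrow> real"
  assumes "finite J" "finite_measure M" "finite_measure N"
    and "\<And>j. j \<in> J \<Longrightarrow> Y j \<in> borel_measurable M"
    and "\<And>j. j \<in> J \<Longrightarrow> Z j \<in> borel_measurable N"
    and "\<And>t. (CLINT x|M. iexp (\<Sum>j\<in>J. t j * Y j x)) = (CLINT x|N. iexp (\<Sum>j\<in>J. t j * Z j x))"
    and "\<And>j. j \<in> J \<Longrightarrow> A j \<in> sets borel"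
  shows "measure M {x \<in> space M. \<forall>j\<in>J. Y j x \<in> A j} = measure N {x \<in> space N. \<forall>j\<in>J. Z j x \<in> A j}"
  using assms
proof (induction J arbitrary: M N rule: finite_induct)
  case empty
  then show ?case by simp
next
  case (insert k J)
  interpret M: finite_measure M by fact
  interpret N: finite_measure N by fact
  have [measurable]: "A k \<in> sets borel" "Y k \<in> borel_measurable M" "Z k \<in> borel_measurable N"
    using insert.prems by auto
  define S where "S t x = (\<Sum>j\<in>J. t j * Y j x)" for t x
  define R where "R t x = (\<Sum>j\<in>J. t j * Z j x)" for t x
  have [measurable]: "S t \<in> borel_measurable M" "R t \<in> borel_measurable N" for t
    using insert.prems unfolding S_def R_def by auto
  have char: "(CLINT x|M. iexp (S t x + s * Y k x)) = (CLINT x|N. iexp (R t x + s * Z k x))" for t s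
  proof -
    have "(\<Sum>j\<in>insert k J. (t(k := s)) j * u j) = (\<Sum>j\<in>J. t j * u j) + s * u k" for u :: "'i \<Rightarrow> real"
    proof -
      have "(\<Sum>j\<in>J. (t(k := s)) j * u j) = (\<Sum>j\<in>J. t j * u j)"
        using insert.hyps by (intro sum.cong) auto
      then show ?thesis using insert.hyps by simp
    qed
    then show ?thesis
      using insert.prems(5)[of "t(k := s)"] by (simp add: S_def R_def)
  qed
  \<comment> \<open>Euler's formula, sorted into exponentials of linear combinations of all coordinates.\<close>
  have cos_iexp: "(1 + cos (a - \<theta>)) *\<^sub>R iexp b
      = iexp b + (iexp (-\<theta>) / 2) * iexp (a + b) + (iexp \<theta> / 2) * iexp (- a + b)" for a b \<theta> :: real
    by (simp add: cos_exp_eq exp_add exp_diff exp_minus scaleR_conv_of_real cos_of_real[symmetric] field_simps)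
  have wchar: "(CLINT x|M. (1 + cos (S t x - \<theta>)) *\<^sub>R iexp (s * Y k x))
      = (CLINT x|N. (1 + cos (R t x - \<theta>)) *\<^sub>R iexp (s * Z k x))" for t \<theta> s
  proof -
    have neg: "- S t x = S (\<lambda>j. - t j) x" "- R t y = R (\<lambda>j. - t j) y" for x y
      by (simp_all add: S_def R_def sum_negf)
    have zero: "S (\<lambda>_. 0) x = 0" "R (\<lambda>_. 0) y = 0" for x y
      by (simp_all add: S_def R_def)
    show ?thesis
      using char[of "\<lambda>_. 0" s] char[of t s] char[of "\<lambda>j. - t j" s]
      unfolding cos_iexp unfolding neg zero
      by (simp add: M.integrable_iexp_bounded N.integrable_iexp_bounded del: of_real_add of_real_mult)
  qed
  have wind: "(\<integral>x. (1 + cos (S t x - \<theta>)) * indicator (A k) (Y k x) \<partial>M)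
      = (\<integral>x. (1 + cos (R t x - \<theta>)) * indicator (A k) (Z k x) \<partial>N)" for t \<theta>
    using cos_le_one cos_ge_minus_one
    by (intro weighted_char_eq_imp_indicator_eq[where B = 2] M.finite_measure_axioms
        N.finite_measure_axioms wchar) (auto simp: real_0_le_add_iff)
  define M' where "M' = density M (\<lambda>x. indicator (A k) (Y k x) :: real)"
  define N' where "N' = density N (\<lambda>x. indicator (A k) (Z k x) :: real)"
  have char': "(CLINT x|M'. iexp (S t x)) = (CLINT x|N'. iexp (R t x))" for t
  proof -
    \<comment> \<open>The added \<open>1\<close> is subtracted again, to recover cosine and sine from the two weights.\<close>
    have trig: "u *\<^sub>R iexp a = complex_of_real ((1 + cos (a - 0)) * u - u)
        + \<i> * complex_of_real ((1 + cos (a - pi / 2)) * u - u)" for a u :: real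
      by (simp add: cis_conv_exp[symmetric] complex_eq_iff cos_diff algebra_simps)
    have iM: "integrable M (\<lambda>x. f x * indicator (A k) (Y k x))"
      if "f \<in> borel_measurable M" "\<And>x. \<bar>f x\<bar> \<le> 2" for f :: "'a \<Rightarrow> real"
      using that by (intro M.integrable_const_bound[where B = 2]) (auto simp: indicator_def)
    have iN: "integrable N (\<lambda>x. f x * indicator (A k) (Z k x))"
      if "f \<in> borel_measurable N" "\<And>x. \<bar>f x\<bar> \<le> 2" for f :: "'b \<Rightarrow> real"
      using that by (intro N.integrable_const_bound[where B = 2]) (auto simp: indicator_def)
    have b: "\<bar>1 + cos x\<bar> \<le> 2" for x :: real
      using cos_le_one[of x] cos_ge_minus_one[of x] by linarith
    have i1: "(\<integral>x. indicator (A k) (Y k x) \<partial>M) = (\<integral>x. (indicator (A k) (Z k x) :: real) \<partial>N)"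
      \<comment> \<open>Here the weight is the constant \<open>2\<close>.\<close>
      using wind[of "\<lambda>_. 0" 0] by (simp add: S_def R_def)
    have [simp]: "integrable M (\<lambda>x. indicator (A k) (Y k x) :: real)"
        "integrable N (\<lambda>x. indicator (A k) (Z k x) :: real)"
      using iM[of "\<lambda>_. 1"] iN[of "\<lambda>_. 1"] by auto
    have "(CLINT x|M. indicator (A k) (Y k x) *\<^sub>R iexp (S t x))
        = (CLINT x|N. indicator (A k) (Z k x) *\<^sub>R iexp (R t x))"
      unfolding trig using wind[of t 0] wind[of t "pi / 2"] i1
      by (simp add: iM iN b del: of_real_add of_real_mult of_real_diff)
    then show ?thesis
      unfolding M'_def N'_def by (simp add: integral_density)
  qed
  have "finite_measure M'" "finite_measure N'"
    unfolding M'_def N'_def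
    by (auto intro!: finite_measureI simp: emeasure_density nn_integral_eq_integral
        M.integrable_const_bound[where B = 1] N.integrable_const_bound[where B = 1])
  then have IH: "measure M' {x \<in> space M'. \<forall>j\<in>J. Y j x \<in> A j} = measure N' {x \<in> space N'. \<forall>j\<in>J. Z j x \<in> A j}"
    using insert.prems char' by (intro insert.IH) (auto simp: M'_def N'_def S_def R_def)
  have [measurable]: "Measurable.pred M (\<lambda>x. \<forall>j\<in>J. Y j x \<in> A j)" "Measurable.pred N (\<lambda>x. \<forall>j\<in>J. Z j x \<in> A j)"
    using insert.prems insert.hyps by (auto intro!: pred_intros_finite pred_sets2)
  have M'_eq: "measure M' {x \<in> space M'. \<forall>j\<in>J. Y j x \<in> A j}
      = measure M {x \<in> space M. \<forall>j\<in>insert k J. Y j x \<in> A j}"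
  proof -
    have "emeasure M' {x \<in> space M. \<forall>j\<in>J. Y j x \<in> A j}
        = (\<integral>\<^sup>+x. indicator {x \<in> space M. \<forall>j\<in>insert k J. Y j x \<in> A j} x \<partial>M)"
      unfolding M'_def
      by (subst emeasure_density) (auto intro!: nn_integral_cong simp: indicator_def simp del: nn_integral_indicator)
    also have "\<dots> = emeasure M {x \<in> space M. \<forall>j\<in>insert k J. Y j x \<in> A j}"
      by (subst nn_integral_indicator) auto
    finally show ?thesis by (simp add: measure_def M'_def)
  qed
  have N'_eq: "measure N' {x \<in> space N'. \<forall>j\<in>J. Z j x \<in> A j}
      = measure N {x \<in> space N. \<forall>j\<in>insert k J. Z j x \<in> A j}"
  proof -
    have "emeasure N' {x \<in> space N. \<forall>j\<in>J. Z j x \<in> A j}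
        = (\<integral>\<^sup>+x. indicator {x \<in> space N. \<forall>j\<in>insert k J. Z j x \<in> A j} x \<partial>N)"
      unfolding N'_def
      by (subst emeasure_density) (auto intro!: nn_integral_cong simp: indicator_def simp del: nn_integral_indicator)
    also have "\<dots> = emeasure N {x \<in> space N. \<forall>j\<in>insert k J. Z j x \<in> A j}"
      by (subst nn_integral_indicator) auto
    finally show ?thesis by (simp add: measure_def N'_def)
  qed
  show ?case using IH unfolding M'_eq N'_eq .
qed

text \<open>
  The laws of the linear combinations determine the characteristic function of the vector, hence
  the measure of all boxes, and boxes generate the product sigma algebra.
\<close>

theorem cramer_wold:
  fixes U V :: "nat \<Rightarrow> 'w \<Rightarrow> real"
  assumes "prob_space P"
    and [measurable]: "\<And>i. i < n \<Longrightarrow> U i \<in> borel_measurable P" "\<And>i. i < n \<Longrightarrow> V i \<in> borel_measurable P"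
    and eq: "\<And>c. distr P borel (\<lambda>\<omega>. \<Sum>i<n. c i * U i \<omega>) = distr P borel (\<lambda>\<omega>. \<Sum>i<n. c i * V i \<omega>)"
  shows "vector_law P n U = vector_law P n V"
proof -
  interpret prob_space P by fact
  have char: "(CLINT x|P. iexp (\<Sum>i<n. c i * U i x)) = (CLINT x|P. iexp (\<Sum>i<n. c i * V i x))" for c
  proof -
    have "(CLINT x|distr P borel (\<lambda>\<omega>. \<Sum>i<n. c i * U i \<omega>). iexp x)
        = (CLINT x|distr P borel (\<lambda>\<omega>. \<Sum>i<n. c i * V i \<omega>). iexp x)"
      by (simp only: eq)
    then show ?thesis by (simp add: integral_distr)
  qed
  have box: "emeasure (vector_law P n W) (Pi\<^sub>E {..<n} A) = measure P {x \<in> space P. \<forall>i\<in>{..<n}. W i x \<in> A i}"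
    if [measurable]: "\<And>i. i < n \<Longrightarrow> W i \<in> borel_measurable P" and A: "\<And>i. i < n \<Longrightarrow> A i \<in> sets borel"
    for W and A :: "nat \<Rightarrow> real set"
  proof -
    have "Pi\<^sub>E {..<n} A \<in> sets (Pi\<^sub>M {..<n} (\<lambda>_. borel))"
      using A by (intro sets_PiM_I_finite) auto
    moreover have "(\<lambda>\<omega>. \<lambda>i\<in>{..<n}. W i \<omega>) \<in> P \<rightarrow>\<^sub>M Pi\<^sub>M {..<n} (\<lambda>_. borel)"
      by (intro measurable_restrict) auto
    moreover have "(\<lambda>\<omega>. \<lambda>i\<in>{..<n}. W i \<omega>) -` Pi\<^sub>E {..<n} A \<inter> space P = {x \<in> space P. \<forall>i\<in>{..<n}. W i x \<in> A i}"
      unfolding vimage_def restrict_PiE_iff by blast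
    ultimately show ?thesis
      unfolding vector_law_def by (simp only: emeasure_distr emeasure_eq_measure[symmetric])
  qed
  show ?thesis
  proof (rule measure_eqI_PiM_finite[where I = "{..<n}" and M = "\<lambda>_. borel" and A = "\<lambda>_. Pi\<^sub>E {..<n} (\<lambda>_. UNIV)"])
    fix A :: "nat \<Rightarrow> real set" assume "\<And>i. i \<in> {..<n} \<Longrightarrow> A i \<in> sets borel"
    then show "emeasure (vector_law P n U) (Pi\<^sub>E {..<n} A) = emeasure (vector_law P n V) (Pi\<^sub>E {..<n} A)"
      using char by (subst (1 2) box) (auto intro!: char_eq_imp_box_eq finite_measure_axioms)
  next
    show "emeasure (vector_law P n U) (Pi\<^sub>E {..<n} (\<lambda>_. UNIV)) \<noteq> \<infinity>"
      by (subst box) auto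
  qed (auto simp: vector_law_def space_PiM intro!: prod_algebraI_finite)
qed

lemma vector_law_eq_imp_moments_eq:
  assumes [measurable]: "U \<in> borel_measurable P" "V \<in> borel_measurable P"
    and eq: "vector_law P 1 (\<lambda>_. U) = vector_law P 1 (\<lambda>_. V)"
  shows "(\<integral>\<omega>. U \<omega> ^ k \<partial>P) = (\<integral>\<omega>. V \<omega> ^ k \<partial>P)"
proof -
  have "(\<integral>\<omega>. W \<omega> ^ k \<partial>P) = (\<integral>x. x 0 ^ k \<partial>vector_law P 1 (\<lambda>_. W))"
    if [measurable]: "W \<in> borel_measurable P" for W
    unfolding vector_law_def by (subst integral_distr) auto
  then show ?thesis using eq by simp
qed

section \<open>Laws of Gaussian vectors\<close>

lemma gaussian_rv_integrable:
  assumes "prob_space P" "gaussian_rv P Y"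
  shows "integrable P Y" "integrable P (\<lambda>\<omega>. (Y \<omega>)\<^sup>2)"
proof -
  interpret prob_space P by fact
  have [measurable]: "Y \<in> borel_measurable P" using assms by (simp add: gaussian_rv_def)
  have "integrable P Y \<and> integrable P (\<lambda>\<omega>. (Y \<omega>)\<^sup>2)"
    using assms(2) unfolding gaussian_rv_def
  proof (elim conjE disjE exE)
    fix c assume c: "AE \<omega> in P. Y \<omega> = c"
    have "integrable P Y" using c by (intro integrable_const_bound[where B = "\<bar>c\<bar>"]) auto
    moreover have "integrable P (\<lambda>\<omega>. (Y \<omega>)\<^sup>2)"
      using c by (intro integrable_const_bound[where B = "c\<^sup>2"]) auto
    ultimately show ?thesis by simp
  next
    fix \<mu> \<sigma> :: real assume s: "0 < \<sigma>" and D: "distributed P lborel Y (normal_density \<mu> \<sigma>)"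
    have "integrable P (\<lambda>\<omega>. (Y \<omega> - \<mu>)\<^sup>2)"
      using distributed_integrable[OF D, of "\<lambda>x. (x - \<mu>)\<^sup>2"] integrable_normal_moment[OF s, of \<mu> 2] by simp
    moreover have Y: "integrable P Y"
      using distributed_integrable[OF D, of "\<lambda>x. x"] integrable_normal_moment_nz_1[OF s] by simp
    ultimately have "integrable P (\<lambda>\<omega>. (Y \<omega> - \<mu>)\<^sup>2 + 2 * \<mu> * Y \<omega> - \<mu>\<^sup>2)" by simp
    then show ?thesis using Y by (simp add: power2_eq_square algebra_simps)
  qed
  then show "integrable P Y" "integrable P (\<lambda>\<omega>. (Y \<omega>)\<^sup>2)" by auto
qed

lemma integrable_mult_of_squares:
  fixes U V :: "'w \<Rightarrow> real"
  assumes [measurable]: "U \<in> borel_measurable P" "V \<in> borel_measurable P"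
    and "integrable P (\<lambda>\<omega>. (U \<omega>)\<^sup>2)" "integrable P (\<lambda>\<omega>. (V \<omega>)\<^sup>2)"
  shows "integrable P (\<lambda>\<omega>. U \<omega> * V \<omega>)"
proof (rule Bochner_Integration.integrable_bound)
  show "integrable P (\<lambda>\<omega>. (U \<omega>)\<^sup>2 + (V \<omega>)\<^sup>2)" using assms by simp
  have "\<bar>a * b\<bar> \<le> a\<^sup>2 + b\<^sup>2" for a b :: real
    using sum_squares_bound[of "\<bar>a\<bar>" "\<bar>b\<bar>"] mult_nonneg_nonneg[OF abs_ge_zero abs_ge_zero, of a b]
    unfolding abs_mult power2_abs by linarith
  then show "AE \<omega> in P. norm (U \<omega> * V \<omega>) \<le> norm ((U \<omega>)\<^sup>2 + (V \<omega>)\<^sup>2)" by simp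
qed measurable

text \<open>
  The parameters in the definition of a Gaussian variable, whether degenerate or not, can be read
  off from its first two moments; this is what makes \<open>gaussian_rv_distr_eq\<close> work.
\<close>

lemma gaussian_rv_cases [consumes 2, case_names const normal]:
  assumes "prob_space P" "gaussian_rv P Y"
  obtains
    (const) "AE \<omega> in P. Y \<omega> = (\<integral>\<omega>. Y \<omega> \<partial>P)" "(\<integral>\<omega>. (Y \<omega>)\<^sup>2 \<partial>P) = (\<integral>\<omega>. Y \<omega> \<partial>P)\<^sup>2"
  | (normal) s where "0 < s" "s\<^sup>2 = (\<integral>\<omega>. (Y \<omega>)\<^sup>2 \<partial>P) - (\<integral>\<omega>. Y \<omega> \<partial>P)\<^sup>2"
      "distributed P lborel Y (normal_density (\<integral>\<omega>. Y \<omega> \<partial>P) s)"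
proof -
  interpret prob_space P by fact
  have [measurable]: "Y \<in> borel_measurable P" using assms by (simp add: gaussian_rv_def)
  show ?thesis
    using assms(2) unfolding gaussian_rv_def
  proof (elim conjE disjE exE)
    fix c assume c: "AE \<omega> in P. Y \<omega> = c"
    have 1: "expectation Y = c"
      using integral_cong_AE[of Y P "\<lambda>_. c"] c by (simp add: prob_space)
    have "AE \<omega> in P. (Y \<omega>)\<^sup>2 = c\<^sup>2" using c by auto
    then have "expectation (\<lambda>\<omega>. (Y \<omega>)\<^sup>2) = c\<^sup>2"
      using integral_cong_AE[of "\<lambda>\<omega>. (Y \<omega>)\<^sup>2" P "\<lambda>_. c\<^sup>2"] by (simp add: prob_space)
    then show ?thesis using c 1 const by simp
  next
    fix \<mu> \<sigma> :: real assume s: "0 < \<sigma>" and D: "distributed P lborel Y (normal_density \<mu> \<sigma>)"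
    have "expectation Y = \<mu>" using normal_distributed_expectation[OF s D] .
    moreover have "variance Y = \<sigma>\<^sup>2" using normal_distributed_variance[OF s D] .
    ultimately show ?thesis
      using normal[of \<sigma>] s D variance_eq[OF gaussian_rv_integrable[OF assms]] by simp
  qed
qed

lemma gaussian_rv_distr_eq:
  assumes "prob_space P" "gaussian_rv P U" "gaussian_rv P V"
    and m1: "(\<integral>\<omega>. U \<omega> \<partial>P) = (\<integral>\<omega>. V \<omega> \<partial>P)"
    and m2: "(\<integral>\<omega>. (U \<omega>)\<^sup>2 \<partial>P) = (\<integral>\<omega>. (V \<omega>)\<^sup>2 \<partial>P)"
  shows "distr P borel U = distr P borel V"
proof -
  have [measurable]: "U \<in> borel_measurable P" "V \<in> borel_measurable P"
    using assms by (auto simp: gaussian_rv_def)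
  have eq: "distr P borel W = distr P lborel W" for W :: "_ \<Rightarrow> real"
    by (rule distr_cong) auto
  show ?thesis
    using assms(1,2)
  proof (cases rule: gaussian_rv_cases)
    case const
    note U = const
    show ?thesis
      using assms(1,3)
    proof (cases rule: gaussian_rv_cases)
      case const
      have "AE \<omega> in P. U \<omega> = V \<omega>"
        using U(1) const(1) unfolding m1 by eventually_elim simp
      then show ?thesis by (intro distr_cong_AE) auto
    next
      case (normal t)
      then show ?thesis using U(2) unfolding m1 m2 by simp
    qed
  next
    case (normal s)
    note U = normal
    show ?thesis
      using assms(1,3)
    proof (cases rule: gaussian_rv_cases)
      case const
      then show ?thesis using U(1,2) unfolding m1 m2 by simp
    next
      case (normal t)
      have "s\<^sup>2 = t\<^sup>2" using U(2) normal(2) unfolding m1 m2 by linarith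
      then have "s = t" using U(1) normal(1) by (rule power2_eq_imp_eq[OF _ less_imp_le less_imp_le])
      then show ?thesis
        using U(3) normal(3) unfolding m1 distributed_def eq by metis
    qed
  qed
qed

lemma gaussian_vector_law_eq:
  fixes U V :: "nat \<Rightarrow> 'w \<Rightarrow> real"
  assumes "prob_space P"
    and U: "\<And>c. gaussian_rv P (\<lambda>\<omega>. \<Sum>i<n. c i * U i \<omega>)"
    and V: "\<And>c. gaussian_rv P (\<lambda>\<omega>. \<Sum>i<n. c i * V i \<omega>)"
    and m1: "\<And>i. i < n \<Longrightarrow> (\<integral>\<omega>. U i \<omega> \<partial>P) = (\<integral>\<omega>. V i \<omega> \<partial>P)"
    and m2: "\<And>i j. i < n \<Longrightarrow> j < n \<Longrightarrow> (\<integral>\<omega>. U i \<omega> * U j \<omega> \<partial>P) = (\<integral>\<omega>. V i \<omega> * V j \<omega> \<partial>P)"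
  shows "vector_law P n U = vector_law P n V"
proof -
  have g: "gaussian_rv P (W i)" if "\<And>c. gaussian_rv P (\<lambda>\<omega>. \<Sum>i<n. c i * W i \<omega>)" "i < n" for W :: "nat \<Rightarrow> 'w \<Rightarrow> real" and i
  proof -
    have "(\<Sum>j<n. (if j = i then 1 else 0) * W j \<omega>) = W i \<omega>" for \<omega>
      using that(2) by (simp add: if_distrib[of "\<lambda>x. x * _"] cong: if_cong)
    then show ?thesis using that(1)[of "\<lambda>j. if j = i then 1 else 0"] by simp
  qed
  have meas: "W i \<in> borel_measurable P" and i1: "integrable P (W i)" and i2: "integrable P (\<lambda>\<omega>. (W i \<omega>)\<^sup>2)"
    if "\<And>c. gaussian_rv P (\<lambda>\<omega>. \<Sum>i<n. c i * W i \<omega>)" "i < n" for W :: "nat \<Rightarrow> 'w \<Rightarrow> real" and i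
    using g[OF that] gaussian_rv_integrable[OF assms(1) g[OF that]] by (auto simp: gaussian_rv_def)
  have e1: "(\<integral>\<omega>. (\<Sum>i<n. c i * W i \<omega>) \<partial>P) = (\<Sum>i<n. c i * (\<integral>\<omega>. W i \<omega> \<partial>P))"
    if "\<And>c. gaussian_rv P (\<lambda>\<omega>. \<Sum>i<n. c i * W i \<omega>)" for W :: "nat \<Rightarrow> 'w \<Rightarrow> real" and c
    using i1[OF that] by (subst Bochner_Integration.integral_sum) auto
  have e2: "(\<integral>\<omega>. (\<Sum>i<n. c i * W i \<omega>)\<^sup>2 \<partial>P) = (\<Sum>i<n. \<Sum>j<n. c i * c j * (\<integral>\<omega>. W i \<omega> * W j \<omega> \<partial>P))"
    if W: "\<And>c. gaussian_rv P (\<lambda>\<omega>. \<Sum>i<n. c i * W i \<omega>)" for W :: "nat \<Rightarrow> 'w \<Rightarrow> real" and c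
  proof -
    have int: "integrable P (\<lambda>\<omega>. W i \<omega> * W j \<omega>)" if "i < n" "j < n" for i j
      using that by (intro integrable_mult_of_squares meas[OF W] i2[OF W])
    have "(\<Sum>i<n. c i * W i \<omega>)\<^sup>2 = (\<Sum>i<n. \<Sum>j<n. c i * c j * (W i \<omega> * W j \<omega>))" for \<omega>
      by (simp add: power2_eq_square sum_product ac_simps)
    then have "(\<integral>\<omega>. (\<Sum>i<n. c i * W i \<omega>)\<^sup>2 \<partial>P) = (\<integral>\<omega>. (\<Sum>i<n. \<Sum>j<n. c i * c j * (W i \<omega> * W j \<omega>)) \<partial>P)"
      by simp
    also have "\<dots> = (\<Sum>i<n. \<integral>\<omega>. (\<Sum>j<n. c i * c j * (W i \<omega> * W j \<omega>)) \<partial>P)"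
      using int by (intro Bochner_Integration.integral_sum Bochner_Integration.integrable_sum) auto
    also have "\<dots> = (\<Sum>i<n. \<Sum>j<n. \<integral>\<omega>. c i * c j * (W i \<omega> * W j \<omega>) \<partial>P)"
      using int by (intro sum.cong refl Bochner_Integration.integral_sum) auto
    finally show ?thesis by simp
  qed
  show ?thesis
  proof (rule cramer_wold[OF assms(1) meas[OF U] meas[OF V]])
    fix c
    show "distr P borel (\<lambda>\<omega>. \<Sum>i<n. c i * U i \<omega>) = distr P borel (\<lambda>\<omega>. \<Sum>i<n. c i * V i \<omega>)"
      using m1 m2 by (intro gaussian_rv_distr_eq assms(1) U V) (simp_all add: e1[OF U] e1[OF V] e2[OF U] e2[OF V])
  qed auto
qed

text \<open>
  The indices \<open>a k\<close> may repeat, whereas the definition of a Gaussian process speaks of distinct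
  indices; coefficients with a common index are added up.
\<close>

lemma gaussian_process_sum:
  assumes X: "gaussian_process P I X" and K: "finite K" "a ` K \<subseteq> I"
  shows "gaussian_rv P (\<lambda>\<omega>. \<Sum>k\<in>K. c k * X (a k) \<omega>)"
proof -
  have "(\<Sum>k\<in>K. c k * X (a k) \<omega>) = (\<Sum>j\<in>a ` K. (\<Sum>k\<in>{k\<in>K. a k = j}. c k) * X j \<omega>)" for \<omega>
    unfolding sum.image_gen[OF K(1), of _ a] sum_distrib_right by (intro sum.cong) auto
  then show ?thesis
    using X K by (simp add: gaussian_process_def)
qed

text \<open>
  An increment uses two indices, so the combination is one over the disjoint union of two copies
  of \<open>K\<close>.
\<close>

lemma gaussian_process_sum_diff:
  assumes X: "gaussian_process P I X" and K: "finite K" "a ` K \<subseteq> I" "b ` K \<subseteq> I"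
  shows "gaussian_rv P (\<lambda>\<omega>. \<Sum>k\<in>K. c k * (X (a k) \<omega> - X (b k) \<omega>))"
proof -
  have "gaussian_rv P (\<lambda>\<omega>. \<Sum>k\<in>K <+> K. case_sum c (\<lambda>k. - c k) k * X (case_sum a b k) \<omega>)"
    using K by (intro gaussian_process_sum[OF X]) auto
  then show ?thesis
    using K(1) by (simp add: sum.Plus right_diff_distrib sum_subtractf sum_negf)
qed
section \<open>Linear algebra of classes of square integrable functions\<close>

lemma L2_class_in_L2: "f \<in> square_integrable m \<Longrightarrow> L2_class m f \<in> L2 m"
  by (simp add: L2_def L2_class_def quotientI)

lemma L2_cases:
  assumes "F \<in> L2 m"
  obtains f where "f \<in> square_integrable m" "F = L2_class m f"
  using assms by (auto simp: L2_def L2_class_def elim: quotientE)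

lemma zero_square_integrable: "(\<lambda>_. 0) \<in> square_integrable m"
  by (simp add: square_integrable_def)

abbreviation L2_zero :: "'t measure \<Rightarrow> ('t \<Rightarrow> real) set" where
  "L2_zero m \<equiv> L2_class m (\<lambda>_. 0)"

lemmas L2_class_simps = L2_add_class L2_scale_class L2_diff_class L2_sq_class L2_class_in_L2
  square_integrable_add square_integrable_scale square_integrable_diff zero_square_integrable

lemma L2_add_in_L2: "F \<in> L2 m \<Longrightarrow> G \<in> L2 m \<Longrightarrow> L2_add m F G \<in> L2 m"
  and L2_diff_in_L2: "F \<in> L2 m \<Longrightarrow> G \<in> L2 m \<Longrightarrow> L2_diff m F G \<in> L2 m"
  and L2_scale_in_L2: "F \<in> L2 m \<Longrightarrow> L2_scale m c F \<in> L2 m"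
  and L2_zero_in_L2: "L2_zero m \<in> L2 m"
  by (auto elim!: L2_cases simp: L2_class_simps)

lemma L2_diff_translate:
  assumes "F \<in> L2 m" "G \<in> L2 m" "K \<in> L2 m"
  shows "L2_diff m (L2_add m F K) (L2_add m G K) = L2_diff m F G"
  using assms by (auto elim!: L2_cases simp: L2_class_simps)

lemma L2_diff_add_cancel:
  assumes "F \<in> L2 m" "G \<in> L2 m"
  shows "L2_add m (L2_diff m F G) G = F"
  using assms by (auto elim!: L2_cases simp: L2_class_simps)

lemma L2_zero_add: "F \<in> L2 m \<Longrightarrow> L2_add m (L2_zero m) F = F"
  by (auto elim!: L2_cases simp: L2_class_simps)

lemma L2_diff_conv_add:
  assumes "F \<in> L2 m" "G \<in> L2 m"
  shows "L2_diff m F G = L2_add m F (L2_scale m (-1) G)"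
  using assms by (auto elim!: L2_cases simp: L2_class_simps square_integrable_scale[of _ m "-1", simplified])

lemma L2_scale_zero: "L2_scale m c (L2_zero m) = L2_zero m"
  by (simp add: L2_class_simps)

lemma L2_sq_zero: "L2_sq m (L2_zero m) = 0"
  by (simp add: L2_class_simps)

lemma L2_sq_nonneg: "0 \<le> L2_sq m F"
  by (simp add: L2_sq_def)

lemma L2_sq_scale: "F \<in> L2 m \<Longrightarrow> L2_sq m (L2_scale m c F) = c\<^sup>2 * L2_sq m F"
  by (auto elim!: L2_cases simp: L2_class_simps power_mult_distrib)

lemma L2_sq_eq_0_iff:
  assumes "F \<in> L2 m"
  shows "L2_sq m F = 0 \<longleftrightarrow> F = L2_zero m"
proof
  assume 0: "L2_sq m F = 0"
  from assms obtain f where f: "f \<in> square_integrable m" "F = L2_class m f" by (rule L2_cases)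
  then have "AE t in m. (f t)\<^sup>2 = 0"
    using 0 integral_nonneg_eq_0_iff_AE[of m "\<lambda>t. (f t)\<^sup>2"]
    by (simp add: L2_class_simps square_integrable_def)
  then have "(\<lambda>_. 0, f) \<in> ae_eq_rel m"
    using f by (auto simp: ae_eq_rel_def zero_square_integrable)
  then show "F = L2_zero m"
    using f by (simp add: L2_class_eqI)
qed (simp add: L2_sq_zero)

lemma L2_norm_eq_iff: "L2_norm m F = L2_norm m G \<longleftrightarrow> L2_sq m F = L2_sq m G"
  by (simp add: L2_norm_def)

lemma L2_norm_nonneg: "0 \<le> L2_norm m F"
  by (simp add: L2_norm_def L2_sq_nonneg)

lemma L2_norm_scale: "F \<in> L2 m \<Longrightarrow> L2_norm m (L2_scale m c F) = \<bar>c\<bar> * L2_norm m F"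
  by (simp add: L2_norm_def L2_sq_scale real_sqrt_mult)

section \<open>Similarities of \<open>L\<^sup>2\<close>: scaling factors, dilations and reflections\<close>

lemma G_mapsD:
  assumes "\<phi> \<in> G_maps m"
  shows "F \<in> L2 m \<Longrightarrow> \<phi> F \<in> L2 m"
    and "F \<in> L2 m \<Longrightarrow> G \<in> L2 m \<Longrightarrow> \<phi> (L2_add m F G) = L2_add m (\<phi> F) (\<phi> G)"
    and "F \<in> L2 m \<Longrightarrow> \<phi> (L2_scale m c F) = L2_scale m c (\<phi> F)"
    and "F \<in> L2 m \<Longrightarrow> G \<in> L2 m \<Longrightarrow> L2_norm m F = L2_norm m G \<Longrightarrow> L2_norm m (\<phi> F) = L2_norm m (\<phi> G)"
  using assms unfolding G_maps_def L2_bounded_linear_def Pi_iff by blast+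

text \<open>
  By linearity, \<open>\<phi>\<close> scales all multiples of one nonzero vector \<open>E\<close> by the same factor, and every
  vector has the norm of a multiple of \<open>E\<close>. So the quotients in the operator norm all equal this
  factor, apart from the value \<open>0 / 0 = 0\<close> at the zero class, which cannot exceed it.
\<close>

lemma L2_norm_G_maps:
  assumes \<phi>: "\<phi> \<in> G_maps m" and F: "F \<in> L2 m"
  shows "L2_norm m (\<phi> F) = L2_onorm m \<phi> * L2_norm m F"
proof (cases "\<exists>E\<in>L2 m. L2_norm m E \<noteq> 0")
  case False
  then show ?thesis using F G_mapsD(1)[OF \<phi>] by auto
next
  case True
  then obtain E where E: "E \<in> L2 m" "L2_norm m E \<noteq> 0" by blast
  define k where "k = L2_norm m (\<phi> E) / L2_norm m E"
  have k: "L2_norm m (\<phi> G) = k * L2_norm m G" if G: "G \<in> L2 m" for G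
  proof -
    define c where "c = L2_norm m G / L2_norm m E"
    have "c \<ge> 0" by (simp add: c_def L2_norm_nonneg)
    then have "L2_norm m G = L2_norm m (L2_scale m c E)"
      using E by (simp add: L2_norm_scale) (simp add: c_def)
    then have "L2_norm m (\<phi> G) = L2_norm m (\<phi> (L2_scale m c E))"
      using G E by (intro G_mapsD(4)[OF \<phi>]) (auto simp: L2_scale_in_L2)
    also have "\<dots> = c * L2_norm m (\<phi> E)"
      using \<open>c \<ge> 0\<close> E by (simp add: G_mapsD(1,3)[OF \<phi>] L2_norm_scale)
    finally show ?thesis by (simp add: c_def k_def)
  qed
  have "L2_onorm m \<phi> = k"
    unfolding L2_onorm_def
  proof (rule cSup_eq_maximum)
    show "k \<in> (\<lambda>F. L2_norm m (\<phi> F) / L2_norm m F) ` L2 m"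
      using E by (auto simp: k_def)
    have "k \<ge> 0" by (simp add: k_def L2_norm_nonneg)
    then show "x \<le> k" if "x \<in> (\<lambda>F. L2_norm m (\<phi> F) / L2_norm m F) ` L2 m" for x
      using that k by (auto simp: divide_simps)
  qed
  then show ?thesis using k F by simp
qed

lemma L2_sq_G_maps:
  assumes "\<phi> \<in> G_maps m" "F \<in> L2 m"
  shows "L2_sq m (\<phi> F) = rho m \<phi> * L2_sq m F"
proof -
  have sq: "L2_sq m G = (L2_norm m G)\<^sup>2" for G
    by (simp add: L2_norm_def L2_sq_nonneg)
  show ?thesis
    unfolding sq L2_norm_G_maps[OF assms] by (simp add: rho_def power_mult_distrib)
qed

lemma G_maps_diff:
  assumes "\<phi> \<in> G_maps m" "F \<in> L2 m" "G \<in> L2 m"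
  shows "\<phi> (L2_diff m F G) = L2_diff m (\<phi> F) (\<phi> G)"
  unfolding L2_diff_conv_add[OF assms(2,3)]
    L2_diff_conv_add[OF G_mapsD(1)[OF assms(1,2)] G_mapsD(1)[OF assms(1,3)]]
  by (simp only: G_mapsD(2)[OF assms(1,2) L2_scale_in_L2[OF assms(3)]] G_mapsD(3)[OF assms(1,3)])

lemma L2_scale_in_G_maps:
  assumes "c \<noteq> 0"
  shows "L2_scale m c \<in> G_maps m"
proof -
  have inv: "L2_scale m a (L2_scale m b F) = F" if "a * b = 1" "F \<in> L2 m" for a b F
    using that(2) by (rule L2_cases)
      (simp add: L2_class_simps mult.assoc[symmetric] that(1))
  have "bij_betw (L2_scale m c) (L2 m) (L2 m)"
    using assms by (intro bij_betw_byWitness[where f' = "L2_scale m (1 / c)"])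
      (auto simp: inv L2_scale_in_L2)
  moreover have "L2_bounded_linear m (L2_scale m c)"
    unfolding L2_bounded_linear_def
  proof (intro conjI ballI allI)
    show "L2_scale m c \<in> L2 m \<rightarrow> L2 m" by (simp add: L2_scale_in_L2)
    show "\<exists>K. \<forall>F\<in>L2 m. L2_norm m (L2_scale m c F) \<le> K * L2_norm m F"
      by (intro exI[of _ "\<bar>c\<bar>"]) (simp add: L2_norm_scale)
  qed (auto elim!: L2_cases simp: L2_class_simps algebra_simps)
  ultimately show ?thesis by (simp add: G_maps_def L2_norm_scale)
qed

lemma rho_eqI:
  assumes "\<phi> \<in> G_maps m" "F \<in> L2 m" "L2_sq m F \<noteq> 0" "L2_sq m (\<phi> F) = r * L2_sq m F"
  shows "rho m \<phi> = r"
  using L2_sq_G_maps[OF assms(1,2)] assms(3,4) by simp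

text \<open>
  With \<open>L\<^sup>2 = {0}\<close> the operator norm of every map is \<open>0\<close>, also for the identity. This degenerate
  case has to be treated apart wherever the value of \<open>rho\<close> matters.
\<close>

lemma rho_trivial:
  assumes "\<phi> \<in> G_maps m" "\<And>F. F \<in> L2 m \<Longrightarrow> L2_sq m F = 0"
  shows "rho m \<phi> = 0"
proof -
  have "(\<lambda>F. L2_norm m (\<phi> F) / L2_norm m F) ` L2 m = {0}"
    using assms(2) L2_zero_in_L2[of m] by (auto simp: L2_norm_def)
  then show ?thesis by (simp add: rho_def L2_onorm_def)
qed

text \<open>
  The Householder reflection \<open>u \<mapsto> u - 2 \<langle>u, v\<rangle> / \<parallel>v\<parallel>\<^sup>2 v\<close> in the hyperplane orthogonal to \<open>v\<close>. The vector
  \<open>v\<close> is a function rather than a class since it enters only through integrals and almost everywhere.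
\<close>

definition L2_reflection :: "'t measure \<Rightarrow> ('t \<Rightarrow> real) \<Rightarrow> ('t \<Rightarrow> real) set \<Rightarrow> ('t \<Rightarrow> real) set" where
  "L2_reflection m v F =
     L2_class m (\<lambda>t. L2_rep F t - 2 * (\<integral>t. L2_rep F t * v t \<partial>m) / (\<integral>t. (v t)\<^sup>2 \<partial>m) * v t)"

lemma square_integrable_mult:
  assumes "f \<in> square_integrable m" "g \<in> square_integrable m"
  shows "integrable m (\<lambda>t. f t * g t)"
  using assms by (auto simp: square_integrable_def intro!: integrable_mult_of_squares)

lemma L2_reflection_class:
  assumes f: "f \<in> square_integrable m" and v: "v \<in> square_integrable m"
  shows "L2_reflection m v (L2_class m f)
    = L2_class m (\<lambda>t. f t - 2 * (\<integral>t. f t * v t \<partial>m) / (\<integral>t. (v t)\<^sup>2 \<partial>m) * v t)"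
proof -
  define c where "c = 2 * (\<integral>t. f t * v t \<partial>m) / (\<integral>t. (v t)\<^sup>2 \<partial>m)"
  have rel: "(f, L2_rep (L2_class m f)) \<in> ae_eq_rel m" using f by (rule L2_rep_class)
  then have AE: "AE t in m. f t = L2_rep (L2_class m f) t" and g: "L2_rep (L2_class m f) \<in> square_integrable m"
    by (auto simp: ae_eq_rel_def)
  have "(\<integral>t. L2_rep (L2_class m f) t * v t \<partial>m) = (\<integral>t. f t * v t \<partial>m)"
    using f v g AE by (intro integral_cong_AE) (auto simp: square_integrable_def elim: eventually_mono)
  then have "L2_reflection m v (L2_class m f) = L2_class m (\<lambda>t. L2_rep (L2_class m f) t - c * v t)"
    by (simp only: L2_reflection_def c_def)
  also have "\<dots> = L2_class m (\<lambda>t. f t - c * v t)"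
    using f v g AE
    by (intro L2_class_eqI) (auto simp: ae_eq_rel_def square_integrable_diff square_integrable_scale elim: eventually_mono)
  finally show ?thesis by (simp only: c_def)
qed

lemma L2_reflection_in_G_maps:
  assumes v: "v \<in> square_integrable m" and v0: "(\<integral>t. (v t)\<^sup>2 \<partial>m) \<noteq> 0"
  shows "L2_reflection m v \<in> G_maps m" "rho m (L2_reflection m v) = 1"
proof -
  define N where "N = (\<integral>t. (v t)\<^sup>2 \<partial>m)"
  have N: "N \<noteq> 0" using v0 by (simp add: N_def)
  define \<phi> where "\<phi> = L2_reflection m v"
  \<comment> \<open>The coefficient of \<open>v\<close> is linear in \<open>f\<close> and takes the value \<open>2\<close> at \<open>v\<close>; the latter makes the
    reflection an involution.\<close>
  define a where "a f = 2 * (\<integral>t. f t * v t \<partial>m) / N" for f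
  have \<phi>: "\<phi> (L2_class m f) = L2_class m (\<lambda>t. f t - a f * v t)"
    if "f \<in> square_integrable m" for f
    using L2_reflection_class[OF that v] by (simp only: \<phi>_def N_def a_def)
  have sqi: "(\<lambda>t. f t - c * v t) \<in> square_integrable m" if "f \<in> square_integrable m" for f c
    using that v by (simp add: L2_class_simps)
  have int [simp]: "integrable m (\<lambda>t. f t * v t)" "integrable m (\<lambda>t. (f t)\<^sup>2)" if "f \<in> square_integrable m" for f
    using square_integrable_mult[OF that v] that by (auto simp: square_integrable_def)
  have in_L2: "\<phi> F \<in> L2 m" if "F \<in> L2 m" for F
    using that by (rule L2_cases) (simp add: \<phi> sqi L2_class_in_L2)
  have a_diff: "a (\<lambda>t. f t - c * v t) = a f - 2 * c"
    if f: "f \<in> square_integrable m" for f c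
  proof -
    have "(\<integral>t. (f t - c * v t) * v t \<partial>m) = (\<integral>t. f t * v t - c * (v t)\<^sup>2 \<partial>m)"
      by (simp add: algebra_simps power2_eq_square)
    also have "\<dots> = (\<integral>t. f t * v t \<partial>m) - c * N"
      using f v by (simp add: N_def)
    finally show ?thesis using N by (simp add: a_def field_simps)
  qed
  have a_add: "a (\<lambda>t. f t + g t) = a f + a g"
    if "f \<in> square_integrable m" "g \<in> square_integrable m" for f g
    using that by (simp add: a_def distrib_right add_divide_distrib)
  have a_scale: "a (\<lambda>t. c * f t) = c * a f" for c f
    by (simp add: a_def mult.assoc)
  have inv: "\<phi> (\<phi> F) = F" if "F \<in> L2 m" for F
    using that
  proof (rule L2_cases)
    fix f assume f: "f \<in> square_integrable m" and F: "F = L2_class m f"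
    show ?thesis
      unfolding F using f N by (simp add: \<phi> sqi a_diff left_diff_distrib)
  qed
  have isom: "L2_sq m (\<phi> F) = L2_sq m F" if "F \<in> L2 m" for F
    using that
  proof (rule L2_cases)
    fix f assume f: "f \<in> square_integrable m" and F: "F = L2_class m f"
    define c where "c = a f"
    have "(\<integral>t. (f t - c * v t)\<^sup>2 \<partial>m) = (\<integral>t. (f t)\<^sup>2 - 2 * c * (f t * v t) + c\<^sup>2 * (v t)\<^sup>2 \<partial>m)"
      by (simp add: power2_diff algebra_simps)
    also have "\<dots> = (\<integral>t. (f t)\<^sup>2 \<partial>m) - 2 * c * (\<integral>t. f t * v t \<partial>m) + c\<^sup>2 * N"
      using f v by (simp add: N_def)
    also have "\<dots> = (\<integral>t. (f t)\<^sup>2 \<partial>m)"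
      using N by (simp add: c_def a_def field_simps power2_eq_square)
    finally show ?thesis
      unfolding F using f by (simp add: \<phi> sqi L2_sq_class c_def)
  qed
  have "L2_bounded_linear m \<phi>"
    unfolding L2_bounded_linear_def
  proof (intro conjI ballI allI)
    show "\<exists>K. \<forall>F\<in>L2 m. L2_norm m (\<phi> F) \<le> K * L2_norm m F"
      by (intro exI[of _ 1]) (simp add: isom L2_norm_def)
    show "\<phi> \<in> L2 m \<rightarrow> L2 m" using in_L2 by simp
    show "\<phi> (L2_add m F G) = L2_add m (\<phi> F) (\<phi> G)" if "F \<in> L2 m" "G \<in> L2 m" for F G
      using that by (auto elim!: L2_cases simp: \<phi> sqi L2_class_simps a_add algebra_simps
          intro!: arg_cong[where f = "L2_class m"])
    show "\<phi> (L2_scale m c F) = L2_scale m c (\<phi> F)" if "F \<in> L2 m" for c F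
      using that by (auto elim!: L2_cases simp: \<phi> sqi L2_class_simps a_scale algebra_simps
          intro!: arg_cong[where f = "L2_class m"])
  qed
  moreover have "bij_betw \<phi> (L2 m) (L2 m)"
    by (intro bij_betw_byWitness[where f' = \<phi>]) (auto simp: inv in_L2)
  ultimately have G: "\<phi> \<in> G_maps m"
    by (simp add: G_maps_def L2_norm_eq_iff isom)
  then show "L2_reflection m v \<in> G_maps m" by (simp add: \<phi>_def)
  have "rho m \<phi> = 1"
    using rho_eqI[OF G, of "L2_class m v" 1] isom[of "L2_class m v"] v v0
    by (simp add: L2_class_in_L2 L2_sq_class)
  then show "rho m (L2_reflection m v) = 1"
    by (simp add: \<phi>_def)
qed

text \<open>
  The reflection along \<open>f - g\<close> exchanges \<open>f\<close> and \<open>g\<close> when their norms agree, because then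
  \<open>2 \<langle>f, f - g\<rangle> = \<parallel>f - g\<parallel>\<^sup>2\<close>.
\<close>

lemma G_maps_transitive_on_spheres:
  assumes F: "F \<in> L2 m" and G: "G \<in> L2 m" and eq: "L2_sq m F = L2_sq m G" and neq: "F \<noteq> G"
  obtains \<phi> where "\<phi> \<in> G_maps m" "rho m \<phi> = 1" "\<phi> F = G"
proof -
  obtain f where f: "f \<in> square_integrable m" "F = L2_class m f" using F by (rule L2_cases)
  obtain g where g: "g \<in> square_integrable m" "G = L2_class m g" using G by (rule L2_cases)
  define v where "v t = f t - g t" for t
  have v: "v \<in> square_integrable m" using f g unfolding v_def by (simp add: L2_class_simps)
  have "L2_diff m F G \<noteq> L2_zero m"
    using L2_diff_add_cancel[OF F G] L2_zero_add[OF G] neq by auto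
  then have v0: "(\<integral>t. (v t)\<^sup>2 \<partial>m) \<noteq> 0"
    using L2_sq_eq_0_iff[OF L2_diff_in_L2[OF F G]] f g v unfolding v_def by (simp add: L2_class_simps)
  have "(\<integral>t. (f t)\<^sup>2 \<partial>m) = (\<integral>t. (g t)\<^sup>2 \<partial>m)"
    using eq f g by (simp add: L2_class_simps)
  moreover have "(\<integral>t. (v t)\<^sup>2 \<partial>m) = (\<integral>t. 2 * (f t * v t) - (f t)\<^sup>2 + (g t)\<^sup>2 \<partial>m)"
    by (simp add: v_def power2_eq_square algebra_simps)
  moreover have "integrable m (\<lambda>t. (f t)\<^sup>2)" "integrable m (\<lambda>t. (g t)\<^sup>2)" "integrable m (\<lambda>t. f t * v t)"
    using f g v square_integrable_mult by (auto simp: square_integrable_def)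
  ultimately have "2 * (\<integral>t. f t * v t \<partial>m) / (\<integral>t. (v t)\<^sup>2 \<partial>m) = 1"
    using v0 by simp
  then have "L2_reflection m v F = G"
    using L2_reflection_class[OF f(1) v] f(2) g(2) by (simp add: v_def)
  then show ?thesis
    using that L2_reflection_in_G_maps[OF v v0] by blast
qed

section \<open>Fractional Brownian motion has the two invariance properties\<close>

lemma gaussian_process_rv:
  assumes "gaussian_process P I X" "i \<in> I"
  shows "gaussian_rv P (X i)"
  using gaussian_process_sum[OF assms(1), of "{i}" "\<lambda>i. i" "\<lambda>_. 1"] assms(2) by simp

text \<open>
  In the bilinear expansion the terms that depend on a single index cancel; only the differences
  between endpoints remain.
\<close>

lemma fBm_increment_covariance:
  assumes "prob_space P" and X: "gaussian_process P (L2 m) X"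
    and cov: "\<And>F G. F \<in> L2 m \<Longrightarrow> G \<in> L2 m \<Longrightarrow> (\<integral>\<omega>. X F \<omega> * X G \<omega> \<partial>P) =
          s / 2 * (L2_sq m F powr (2 * H) + L2_sq m G powr (2 * H) - L2_sq m (L2_diff m F G) powr (2 * H))"
    and mem: "A \<in> L2 m" "B \<in> L2 m" "C \<in> L2 m" "D \<in> L2 m"
  shows "(\<integral>\<omega>. (X A \<omega> - X B \<omega>) * (X C \<omega> - X D \<omega>) \<partial>P) =
    s / 2 * (L2_sq m (L2_diff m A D) powr (2 * H) + L2_sq m (L2_diff m B C) powr (2 * H)
      - L2_sq m (L2_diff m A C) powr (2 * H) - L2_sq m (L2_diff m B D) powr (2 * H))"
proof -
  have int: "integrable P (\<lambda>\<omega>. X F \<omega> * X G \<omega>)" if "F \<in> L2 m" "G \<in> L2 m" for F G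
    using gaussian_process_rv[OF X that(1)] gaussian_process_rv[OF X that(2)] assms(1)
    by (intro integrable_mult_of_squares gaussian_rv_integrable) (auto simp: gaussian_rv_def)
  have "(\<integral>\<omega>. (X A \<omega> - X B \<omega>) * (X C \<omega> - X D \<omega>) \<partial>P)
      = (\<integral>\<omega>. X A \<omega> * X C \<omega> - X A \<omega> * X D \<omega> - (X B \<omega> * X C \<omega> - X B \<omega> * X D \<omega>) \<partial>P)"
    by (simp add: algebra_simps)
  also have "\<dots> = (\<integral>\<omega>. X A \<omega> * X C \<omega> \<partial>P) - (\<integral>\<omega>. X A \<omega> * X D \<omega> \<partial>P)
      - ((\<integral>\<omega>. X B \<omega> * X C \<omega> \<partial>P) - (\<integral>\<omega>. X B \<omega> * X D \<omega> \<partial>P))"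
    using mem by (simp add: int)
  finally show ?thesis
    unfolding cov[OF mem(1,3)] cov[OF mem(1,4)] cov[OF mem(2,3)] cov[OF mem(2,4)]
    by (simp add: algebra_simps)
qed

lemma fBm_imp_increment_stationary:
  fixes m :: "'t measure"
  assumes P: "prob_space P" and X: "gaussian_process P (L2 m) X"
    and fBm: "L2_fBm_up_to_variance m P H X"
  shows "weak_L2_increment_stationary m P X"
  unfolding weak_L2_increment_stationary_def
proof (intro allI ballI)
  fix n :: nat and f g :: "nat \<Rightarrow> ('t \<Rightarrow> real) set" and h
  assume f: "f \<in> {..<n} \<rightarrow> L2 m" and g: "g \<in> {..<n} \<rightarrow> L2 m" and h: "h \<in> L2 m"
  obtain s where mean: "\<And>F. F \<in> L2 m \<Longrightarrow> (\<integral>\<omega>. X F \<omega> \<partial>P) = 0"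
    and cov: "\<And>F G. F \<in> L2 m \<Longrightarrow> G \<in> L2 m \<Longrightarrow> (\<integral>\<omega>. X F \<omega> * X G \<omega> \<partial>P) =
          s / 2 * (L2_sq m F powr (2 * H) + L2_sq m G powr (2 * H) - L2_sq m (L2_diff m F G) powr (2 * H))"
    using fBm unfolding L2_fBm_up_to_variance_def by blast
  have mem: "f i \<in> L2 m" "g i \<in> L2 m" "L2_add m (f i) h \<in> L2 m" "L2_add m (g i) h \<in> L2 m" if "i < n" for i
    using that f g h by (auto intro!: L2_add_in_L2)
  have mean_diff: "(\<integral>\<omega>. X F \<omega> - X G \<omega> \<partial>P) = 0" if "F \<in> L2 m" "G \<in> L2 m" for F G
    using that gaussian_rv_integrable(1)[OF P gaussian_process_rv[OF X]] by (simp add: mean)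
  have increments: "(\<integral>\<omega>. (X A \<omega> - X B \<omega>) * (X C \<omega> - X D \<omega>) \<partial>P) =
      s / 2 * (L2_sq m (L2_diff m A D) powr (2 * H) + L2_sq m (L2_diff m B C) powr (2 * H)
        - L2_sq m (L2_diff m A C) powr (2 * H) - L2_sq m (L2_diff m B D) powr (2 * H))"
    if "A \<in> L2 m" "B \<in> L2 m" "C \<in> L2 m" "D \<in> L2 m" for A B C D
    using that by (intro fBm_increment_covariance[OF P X] cov)
  show "vector_law P n (\<lambda>i \<omega>. X (L2_add m (f i) h) \<omega> - X (L2_add m (g i) h) \<omega>) =
        vector_law P n (\<lambda>i \<omega>. X (f i) \<omega> - X (g i) \<omega>)"
  proof (rule gaussian_vector_law_eq[OF P])
    fix c
    show "gaussian_rv P (\<lambda>\<omega>. \<Sum>i<n. c i * (X (L2_add m (f i) h) \<omega> - X (L2_add m (g i) h) \<omega>))"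
      and "gaussian_rv P (\<lambda>\<omega>. \<Sum>i<n. c i * (X (f i) \<omega> - X (g i) \<omega>))"
      using mem by (auto intro!: gaussian_process_sum_diff[OF X])
  next
    fix i j assume i: "i < n" and j: "j < n"
    show "(\<integral>\<omega>. (X (L2_add m (f i) h) \<omega> - X (L2_add m (g i) h) \<omega>) * (X (L2_add m (f j) h) \<omega> - X (L2_add m (g j) h) \<omega>) \<partial>P)
      = (\<integral>\<omega>. (X (f i) \<omega> - X (g i) \<omega>) * (X (f j) \<omega> - X (g j) \<omega>) \<partial>P)"
      by (simp only: increments mem[OF i] mem[OF j] L2_diff_translate h)
  qed (simp add: mean_diff mem)
qed

lemma fBm_imp_self_similar:
  fixes m :: "'t measure"
  assumes P: "prob_space P" and X: "gaussian_process P (L2 m) X"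
    and fBm: "L2_fBm_up_to_variance m P H X"
  shows "strong_self_similar m P H X"
  unfolding strong_self_similar_def same_fdds_def
proof (intro allI ballI)
  fix \<phi> and n :: nat and f :: "nat \<Rightarrow> ('t \<Rightarrow> real) set"
  assume \<phi>: "\<phi> \<in> G_maps m" and f: "f \<in> {..<n} \<rightarrow> L2 m"
  obtain s where mean: "\<And>F. F \<in> L2 m \<Longrightarrow> (\<integral>\<omega>. X F \<omega> \<partial>P) = 0"
    and cov: "\<And>F G. F \<in> L2 m \<Longrightarrow> G \<in> L2 m \<Longrightarrow> (\<integral>\<omega>. X F \<omega> * X G \<omega> \<partial>P) =
          s / 2 * (L2_sq m F powr (2 * H) + L2_sq m G powr (2 * H) - L2_sq m (L2_diff m F G) powr (2 * H))"
    using fBm unfolding L2_fBm_up_to_variance_def by blast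
  define r where "r = rho m \<phi> powr H"
  have r2: "r * r = rho m \<phi> powr (2 * H)"
    by (simp add: r_def powr_add[symmetric])
  have sq: "L2_sq m (\<phi> F) powr (2 * H) = r * r * L2_sq m F powr (2 * H)" if "F \<in> L2 m" for F
    using L2_sq_G_maps[OF \<phi> that] by (simp add: r2 powr_mult rho_def L2_sq_nonneg)
  have mem: "f i \<in> L2 m" "\<phi> (f i) \<in> L2 m" if "i < n" for i
    using that f by (auto intro!: G_mapsD(1)[OF \<phi>])
  show "vector_law P n (\<lambda>i. X (\<phi> (f i))) = vector_law P n (\<lambda>i \<omega>. rho m \<phi> powr H * X (f i) \<omega>)"
    unfolding r_def[symmetric]
  proof (rule gaussian_vector_law_eq[OF P])
    fix c
    show "gaussian_rv P (\<lambda>\<omega>. \<Sum>i<n. c i * X (\<phi> (f i)) \<omega>)"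
      using mem by (auto intro!: gaussian_process_sum[OF X])
    have "gaussian_rv P (\<lambda>\<omega>. \<Sum>i<n. (c i * r) * X (f i) \<omega>)"
      using mem by (intro gaussian_process_sum[OF X]) auto
    then show "gaussian_rv P (\<lambda>\<omega>. \<Sum>i<n. c i * (r * X (f i) \<omega>))"
      by (simp add: mult.assoc)
  next
    fix i j assume i: "i < n" and j: "j < n"
    have "(\<integral>\<omega>. (r * X (f i) \<omega>) * (r * X (f j) \<omega>) \<partial>P) = (\<integral>\<omega>. r * r * (X (f i) \<omega> * X (f j) \<omega>) \<partial>P)"
      by (simp add: ac_simps)
    also have "\<dots> = r * r * (\<integral>\<omega>. X (f i) \<omega> * X (f j) \<omega> \<partial>P)"
      by simp
    also have "\<dots> = (\<integral>\<omega>. X (\<phi> (f i)) \<omega> * X (\<phi> (f j)) \<omega> \<partial>P)"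
      using mem i j
      by (simp add: cov G_maps_diff[OF \<phi>, symmetric] sq L2_diff_in_L2) (simp add: algebra_simps)
    finally show "(\<integral>\<omega>. X (\<phi> (f i)) \<omega> * X (\<phi> (f j)) \<omega> \<partial>P) = (\<integral>\<omega>. (r * X (f i) \<omega>) * (r * X (f j) \<omega>) \<partial>P)"
      by simp
  qed (simp add: mean mem)
qed

section \<open>The two invariance properties determine the covariance\<close>

lemma self_similar_moments:
  assumes X: "gaussian_process P (L2 m) X" and SS: "strong_self_similar m P H X"
    and \<phi>: "\<phi> \<in> G_maps m" and F: "F \<in> L2 m"
  shows "(\<integral>\<omega>. X (\<phi> F) \<omega> ^ k \<partial>P) = (rho m \<phi> powr H) ^ k * (\<integral>\<omega>. X F \<omega> ^ k \<partial>P)"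
proof -
  have [measurable]: "X F \<in> borel_measurable P" "X (\<phi> F) \<in> borel_measurable P"
    using X F G_mapsD(1)[OF \<phi> F] by (auto simp: gaussian_process_def)
  have "vector_law P 1 (\<lambda>_. X (\<phi> F)) = vector_law P 1 (\<lambda>_ \<omega>. rho m \<phi> powr H * X F \<omega>)"
    using SS[unfolded strong_self_similar_def same_fdds_def, rule_format, OF \<phi>, of "\<lambda>_. F" 1] F
    by simp
  then have "(\<integral>\<omega>. X (\<phi> F) \<omega> ^ k \<partial>P) = (\<integral>\<omega>. (rho m \<phi> powr H * X F \<omega>) ^ k \<partial>P)"
    by (intro vector_law_eq_imp_moments_eq) auto
  then show ?thesis by (simp add: power_mult_distrib)
qed

text \<open>
  Translating both indices by \<open>G\<close> carries the increment between \<open>0\<close> and \<open>F - G\<close> to the one between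
  \<open>G\<close> and \<open>F\<close>.
\<close>

lemma increment_stationary_moments:
  assumes X: "gaussian_process P (L2 m) X" and SI: "weak_L2_increment_stationary m P X"
    and F: "F \<in> L2 m" and G: "G \<in> L2 m"
  shows "(\<integral>\<omega>. (X F \<omega> - X G \<omega>) ^ k \<partial>P) = (\<integral>\<omega>. (X (L2_diff m F G) \<omega> - X (L2_zero m) \<omega>) ^ k \<partial>P)"
proof -
  have meas [measurable]: "X K \<in> borel_measurable P" if "K \<in> L2 m" for K
    using X that by (auto simp: gaussian_process_def)
  have "vector_law P 1 (\<lambda>_ \<omega>. X (L2_add m (L2_diff m F G) G) \<omega> - X (L2_add m (L2_zero m) G) \<omega>)
      = vector_law P 1 (\<lambda>_ \<omega>. X (L2_diff m F G) \<omega> - X (L2_zero m) \<omega>)"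
    using SI[unfolded weak_L2_increment_stationary_def, rule_format,
        of "\<lambda>_. L2_diff m F G" 1 "\<lambda>_. L2_zero m" G] F G
    by (simp add: L2_diff_in_L2 L2_zero_in_L2)
  then have "vector_law P 1 (\<lambda>_ \<omega>. X F \<omega> - X G \<omega>) = vector_law P 1 (\<lambda>_ \<omega>. X (L2_diff m F G) \<omega> - X (L2_zero m) \<omega>)"
    using F G by (simp only: L2_diff_add_cancel L2_zero_add)
  then show ?thesis
    using F G by (intro vector_law_eq_imp_moments_eq) (auto simp: L2_diff_in_L2 L2_zero_in_L2)
qed

text \<open>
  The dilation by \<open>2\<close> fixes the zero class, so self-similarity multiplies \<open>E(X\<^sub>0\<^sup>2)\<close> by a power of
  \<open>rho\<close> without changing it. It has \<open>rho = 4\<close>, or \<open>rho = 0\<close> if \<open>L\<^sup>2\<close> is trivial; in both cases the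
  power differs from \<open>1\<close>.
\<close>

lemma self_similar_zero:
  assumes P: "prob_space P" and X: "gaussian_process P (L2 m) X" and SS: "strong_self_similar m P H X"
    and H: "0 < H"
  shows "AE \<omega> in P. X (L2_zero m) \<omega> = 0"
proof -
  define \<phi> where "\<phi> = L2_scale m 2"
  have \<phi>: "\<phi> \<in> G_maps m" unfolding \<phi>_def by (rule L2_scale_in_G_maps) simp
  have "rho m \<phi> \<noteq> 1"
  proof (cases "\<forall>F\<in>L2 m. L2_sq m F = 0")
    case True
    then show ?thesis using rho_trivial[OF \<phi>] by simp
  next
    case False
    then obtain F where "F \<in> L2 m" "L2_sq m F \<noteq> 0" by blast
    then show ?thesis using rho_eqI[OF \<phi>, of F 4] by (simp add: \<phi>_def L2_sq_scale)
  qed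
  moreover have "0 \<le> rho m \<phi>" by (simp add: rho_def)
  ultimately have "rho m \<phi> powr H \<noteq> 1"
    using H powr_powr[of "rho m \<phi>" H "1 / H"] by auto
  then have "(rho m \<phi> powr H)\<^sup>2 \<noteq> 1"
    using powr_ge_zero[of "rho m \<phi>" H] by (auto simp: power2_eq_1_iff simp del: powr_ge_zero)
  moreover have "\<phi> (L2_zero m) = L2_zero m" by (simp add: \<phi>_def L2_scale_zero)
  ultimately have "(\<integral>\<omega>. (X (L2_zero m) \<omega>)\<^sup>2 \<partial>P) = 0"
    using self_similar_moments[OF X SS \<phi> L2_zero_in_L2, of 2] by simp
  then show ?thesis
    using integral_nonneg_eq_0_iff_AE[of P "\<lambda>\<omega>. (X (L2_zero m) \<omega>)\<^sup>2"]
      gaussian_rv_integrable(2)[OF P gaussian_process_rv[OF X L2_zero_in_L2]] by simp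
qed

lemma increment_moments:
  assumes P: "prob_space P" and X: "gaussian_process P (L2 m) X"
    and SI: "weak_L2_increment_stationary m P X" and SS: "strong_self_similar m P H X"
    and H: "0 < H" and F: "F \<in> L2 m" and G: "G \<in> L2 m"
  shows "(\<integral>\<omega>. (X F \<omega> - X G \<omega>) ^ k \<partial>P) = (\<integral>\<omega>. X (L2_diff m F G) \<omega> ^ k \<partial>P)"
proof -
  have [measurable]: "X K \<in> borel_measurable P" if "K \<in> L2 m" for K
    using X that by (auto simp: gaussian_process_def)
  have "(\<integral>\<omega>. (X (L2_diff m F G) \<omega> - X (L2_zero m) \<omega>) ^ k \<partial>P) = (\<integral>\<omega>. X (L2_diff m F G) \<omega> ^ k \<partial>P)"
    using self_similar_zero[OF P X SS H] F G
    by (intro integral_cong_AE) (auto simp: L2_diff_in_L2 L2_zero_in_L2 elim: eventually_mono)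
  then show ?thesis
    using increment_stationary_moments[OF X SI F G] by simp
qed

text \<open>
  The variable \<open>X\<^bsub>- F\<^esub>\<close> has the mean of \<open>X\<^sub>F\<close> by self-similarity under \<open>- id\<close>, and the mean of
  \<open>X\<^sub>0 - X\<^sub>F = - X\<^sub>F\<close> by stationarity.
\<close>

lemma increment_stationary_self_similar_centred:
  assumes P: "prob_space P" and X: "gaussian_process P (L2 m) X"
    and SI: "weak_L2_increment_stationary m P X" and SS: "strong_self_similar m P H X"
    and H: "0 < H" and F: "F \<in> L2 m"
  shows "(\<integral>\<omega>. X F \<omega> \<partial>P) = 0"
proof (cases "L2_sq m F = 0")
  case True
  then have "AE \<omega> in P. X F \<omega> = 0"
    using self_similar_zero[OF P X SS H] F by (simp add: L2_sq_eq_0_iff)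
  then show ?thesis by (rule integral_eq_zero_AE)
next
  case False
  have \<phi>: "L2_scale m (-1) \<in> G_maps m" by (rule L2_scale_in_G_maps) simp
  have "rho m (L2_scale m (-1)) = 1"
    using rho_eqI[OF \<phi> F False, of 1] F by (simp add: L2_sq_scale)
  then have "(\<integral>\<omega>. X (L2_scale m (-1) F) \<omega> \<partial>P) = (\<integral>\<omega>. X F \<omega> \<partial>P)"
    using self_similar_moments[OF X SS \<phi> F, of 1] by simp
  moreover have "L2_diff m (L2_zero m) F = L2_scale m (-1) F"
    using F by (simp add: L2_diff_conv_add L2_zero_in_L2 L2_zero_add L2_scale_in_L2)
  moreover have "(\<integral>\<omega>. X (L2_zero m) \<omega> - X F \<omega> \<partial>P) = - (\<integral>\<omega>. X F \<omega> \<partial>P)"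
    using gaussian_rv_integrable(1)[OF P gaussian_process_rv[OF X]] F
      integral_eq_zero_AE[OF self_similar_zero[OF P X SS H]]
    by (simp add: L2_zero_in_L2)
  ultimately show ?thesis
    using increment_moments[OF P X SI SS H L2_zero_in_L2 F, of 1] by simp
qed

text \<open>
  Fix a nonzero \<open>E\<close>. A dilation carries \<open>E\<close> to a vector with the norm of \<open>F\<close>, and a reflection with
  \<open>rho = 1\<close> carries that vector to \<open>F\<close>. So \<open>E(X\<^sub>F\<^sup>2)\<close> is determined by the second moment at \<open>E\<close> and
  the ratio of the norms.
\<close>

lemma self_similar_second_moment:
  assumes P: "prob_space P" and X: "gaussian_process P (L2 m) X"
    and SS: "strong_self_similar m P H X" and H: "0 < H"
  obtains s where "s \<ge> 0"
    "\<And>F. F \<in> L2 m \<Longrightarrow> (\<integral>\<omega>. (X F \<omega>)\<^sup>2 \<partial>P) = s * L2_sq m F powr (2 * H)"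
proof -
  define S where "S F = (\<integral>\<omega>. (X F \<omega>)\<^sup>2 \<partial>P)" for F
  have zero: "S F = 0" if "F \<in> L2 m" "L2_sq m F = 0" for F
  proof -
    have "AE \<omega> in P. (X F \<omega>)\<^sup>2 = 0"
      using self_similar_zero[OF P X SS H] that by (simp add: L2_sq_eq_0_iff)
    then show ?thesis unfolding S_def by (rule integral_eq_zero_AE)
  qed
  have scaling: "S (\<phi> F) = rho m \<phi> powr (2 * H) * S F" if "\<phi> \<in> G_maps m" "F \<in> L2 m" for \<phi> F
    using self_similar_moments[OF X SS that, of 2] by (simp add: S_def power2_eq_square[of "_ powr _"] flip: powr_add)
  show ?thesis
  proof (cases "\<forall>F\<in>L2 m. L2_sq m F = 0")
    case True
    then show ?thesis using that[of 0] zero by (simp add: S_def)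
  next
    case False
    then obtain E where E: "E \<in> L2 m" "L2_sq m E \<noteq> 0" by blast
    then have E_pos: "0 < L2_sq m E" using L2_sq_nonneg[of m E] by linarith
    define s where "s = S E / L2_sq m E powr (2 * H)"
    have "S F = s * L2_sq m F powr (2 * H)" if F: "F \<in> L2 m" for F
    proof (cases "L2_sq m F = 0")
      case True
      then show ?thesis using zero F by simp
    next
      case False
      then have F_pos: "0 < L2_sq m F" using L2_sq_nonneg[of m F] by linarith
      define c where "c = sqrt (L2_sq m F / L2_sq m E)"
      have c: "c \<noteq> 0" "c\<^sup>2 = L2_sq m F / L2_sq m E" using E_pos F_pos by (auto simp: c_def)
      define E' where "E' = L2_scale m c E"
      have E': "E' \<in> L2 m" "L2_sq m E' = L2_sq m F"
        using E c by (auto simp: E'_def L2_scale_in_L2 L2_sq_scale)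
      have "rho m (L2_scale m c) = L2_sq m F / L2_sq m E"
        using rho_eqI[OF L2_scale_in_G_maps[OF c(1)] E] E c by (simp add: L2_sq_scale)
      then have "S E' = s * L2_sq m F powr (2 * H)"
        using scaling[OF L2_scale_in_G_maps[OF c(1)] E(1)] E_pos F_pos
        by (simp add: E'_def s_def powr_divide)
      moreover have "S F = S E'"
      proof (cases "E' = F")
        case False
        then obtain \<phi> where "\<phi> \<in> G_maps m" "rho m \<phi> = 1" "\<phi> E' = F"
          using G_maps_transitive_on_spheres[OF E'(1) F E'(2)] by blast
        then show ?thesis using scaling[of \<phi> E'] E' by simp
      qed simp
      ultimately show ?thesis by simp
    qed
    moreover have "0 \<le> s" by (simp add: s_def S_def)
    ultimately show ?thesis using that[of s] by (simp add: S_def)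
  qed
qed

text \<open>
  Polarization: \<open>X\<^sub>F - X\<^sub>G\<close> has the second moment of \<open>X\<^bsub>F - G\<^esub>\<close>, and
  \<open>2 X\<^sub>F X\<^sub>G = X\<^sub>F\<^sup>2 + X\<^sub>G\<^sup>2 - (X\<^sub>F - X\<^sub>G)\<^sup>2\<close>.
\<close>

lemma increment_stationary_self_similar_imp_fBm:
  assumes P: "prob_space P" and X: "gaussian_process P (L2 m) X"
    and SI: "weak_L2_increment_stationary m P X" and SS: "strong_self_similar m P H X"
    and H: "0 < H"
  shows "L2_fBm_up_to_variance m P H X"
proof -
  obtain s where s: "s \<ge> 0"
    and var: "\<And>F. F \<in> L2 m \<Longrightarrow> (\<integral>\<omega>. (X F \<omega>)\<^sup>2 \<partial>P) = s * L2_sq m F powr (2 * H)"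
    using self_similar_second_moment[OF P X SS H] by blast
  have "(\<integral>\<omega>. X F \<omega> * X G \<omega> \<partial>P) =
      s / 2 * (L2_sq m F powr (2 * H) + L2_sq m G powr (2 * H) - L2_sq m (L2_diff m F G) powr (2 * H))"
    if F: "F \<in> L2 m" and G: "G \<in> L2 m" for F G
  proof -
    have rv: "gaussian_rv P (X F)" "gaussian_rv P (X G)"
      using X F G by (auto intro: gaussian_process_rv)
    then have int: "integrable P (\<lambda>\<omega>. (X F \<omega>)\<^sup>2)" "integrable P (\<lambda>\<omega>. (X G \<omega>)\<^sup>2)"
      and int': "integrable P (\<lambda>\<omega>. X F \<omega> * X G \<omega>)"
      by (auto intro!: integrable_mult_of_squares gaussian_rv_integrable(2)[OF P]) (auto simp: gaussian_rv_def)
    have "(\<integral>\<omega>. (X F \<omega> - X G \<omega>)\<^sup>2 \<partial>P) = (\<integral>\<omega>. (X F \<omega>)\<^sup>2 + (X G \<omega>)\<^sup>2 - 2 * (X F \<omega> * X G \<omega>) \<partial>P)"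
      by (simp add: power2_diff mult.assoc)
    also have "\<dots> = (\<integral>\<omega>. (X F \<omega>)\<^sup>2 \<partial>P) + (\<integral>\<omega>. (X G \<omega>)\<^sup>2 \<partial>P) - 2 * (\<integral>\<omega>. X F \<omega> * X G \<omega> \<partial>P)"
      using int int' by simp
    finally show ?thesis
      using increment_moments[OF P X SI SS H F G, of 2] var F G L2_diff_in_L2[OF F G]
      by (simp add: algebra_simps)
  qed
  then show ?thesis
    using s increment_stationary_self_similar_centred[OF P X SI SS H]
    unfolding L2_fBm_up_to_variance_def by blast
qed

theorem proposition3p2:
  fixes m :: "'t::polish_space measure"
    and P :: "'w measure"
    and X :: "('t \<Rightarrow> real) set \<Rightarrow> 'w \<Rightarrow> real"
    and H :: real
  assumes "sets m = sets borel"
    and "L2_separable m"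
    and "0 < H" and "H < 1"
    and "prob_space P"
    and "gaussian_process P (L2 m) X"
  shows "L2_fBm_up_to_variance m P H X \<longleftrightarrow>
         weak_L2_increment_stationary m P X \<and> strong_self_similar m P H X"
  using fBm_imp_increment_stationary[OF assms(5,6)] fBm_imp_self_similar[OF assms(5,6)]
    increment_stationary_self_similar_imp_fBm[OF assms(5,6) _ _ assms(3)]
  by blast

end
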